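(* Let $n,m,d\ge1$ be integers, let $\lambda_1,\dots,\lambda_n\in\mathbb C$, and for $t\in\mathbb C^m$ consider the germ at $0\in\mathbb C^n$ of holomorphic vector field $$\dot z_j=\lambda_jz_j+\sum_{i\in\mathbb N^m,\ 1\le|i|\le d}t^if_{j,i}(z),\qquad 1\le j\le n,$$ where the $f_{j,i}$ are germs of holomorphic functions at $0$ vanishing to order at least $2$. Assume that the linear part is non-resonant, that is, for all $(n_1,\dots,n_n)\in\mathbb N^n$ with $n_1+\dots+n_n\ge2$ and all $1\le j\le n$, $$\sum_{k=1}^nn_k\lambda_k-\lambda_j\ne0.$$ Then one of the following two alternatives holds: 1) The holomorphic vector field is (holomorphically) linearizable at $0$ for all $t\in\mathbb C^m$. 2) There is a set $E\subset\mathbb C^m$ of $\Gamma$-capacity $0$ such that for every $t\in\mathbb C^m\setminus E$ the holomorphic vector field is not linearizable at $0$.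
   Context: Notation: $|i|=i_1+\dots+i_m$ and $t^i=t_1^{i_1}\cdots t_m^{i_m}$. The vector field is linearizable at $0$ if there is a germ of holomorphic diffeomorphism $w=h(z)$ of $(\mathbb C^n,0)$ with $h(0)=0$, $D_0h=I$, transforming it into the linear system $\dot w_j=\lambda_jw_j$, $1\le j\le n$. $\Gamma$-capacity: for $E\subset\mathbb C$, $\mathrm{Cap}(E)$ is the logarithmic capacity, $\mathrm{Cap}(E)=\sup_\mu e^{I(\mu)}$, with $I(\mu)=\iint\log|z-w|\,d\mu(z)d\mu(w)$ and $\mu$ ranging over Borel probability measures with compact support in $E$ (with $\mathrm{Cap}(\emptyset)=0$). For $E\subset\mathbb C^m$, $m\ge2$, let $\Gamma_m^{m-1}(E)$ be the set of $z\in\mathbb C^{m-1}$ such that $\{w\in\mathbb C:(z,w)\in E\}$ has positive capacity, and let $\Gamma_m^1(E)=\Gamma_2^1\circ\Gamma_3^2\circ\cdots\circ\Gamma_m^{m-1}(E)\subset\mathbb C$ (with $\Gamma_1^1(E)=E$ when $m=1$). Then $\Gamma\text{-Cap}(E)=\sup_{U\in U(m,\mathbb C)}\mathrm{Cap}\,\Gamma_m^1(U(E))$, $U$ ranging over unitary transformations of $\mathbb C^m$. *)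

theory Defs
  imports "HOL-Probability.Probability" "Jordan_Normal_Form.Schur_Decomposition"
begin

text \<open>
  Phase space is the Euclidean space of complex vectors indexed by a finite type, which carries
  the derivatives and the topology. Parameter space is the carrier of complex vectors of length
  \<open>m\<close>, because the \<open>\<Gamma>\<close>-capacity is defined by recursion on the dimension. Only
  the dollar sign of the former is kept as notation.
\<close>

no_notation Matrix.vec_index (infixl \<open>$\<close> 100)

section \<open>Germs of holomorphic functions and maps\<close>

text \<open>Holomorphy in several variables: a complex-linear Frechet derivative at every point.\<close>

definition holomorphic_several_on ::
    "(complex ^ 'n \<Rightarrow> complex) \<Rightarrow> (complex ^ 'n) set \<Rightarrow> bool" where
  "holomorphic_several_on f S \<longleftrightarrow>
     (\<forall>z\<in>S. \<exists>D. (f has_derivative D) (at z) \<and> (\<forall>c v. D (c *s v) = c * D v))"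

definition holomorphic_map_on ::
    "(complex ^ 'n \<Rightarrow> complex ^ 'k) \<Rightarrow> (complex ^ 'n) set \<Rightarrow> bool" where
  "holomorphic_map_on h S \<longleftrightarrow> (\<forall>k. holomorphic_several_on (\<lambda>z. h z $ k) S)"

text \<open>Germs are given by representatives; every notion below depends only on the germ at 0.\<close>

definition holomorphic_germ_at_0 :: "(complex ^ 'n \<Rightarrow> complex) \<Rightarrow> bool" where
  "holomorphic_germ_at_0 f \<longleftrightarrow> (\<exists>S. open S \<and> 0 \<in> S \<and> holomorphic_several_on f S)"

text \<open>The Taylor expansion at 0 has no terms of degree 0 and 1.\<close>

definition vanishes_to_order_2_at_0 :: "(complex ^ 'n \<Rightarrow> complex) \<Rightarrow> bool" where
  "vanishes_to_order_2_at_0 f \<longleftrightarrow> f 0 = 0 \<and> (f has_derivative (\<lambda>_. 0)) (at 0)"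

text \<open>A germ of biholomorphism of \<open>(\<complex>\<^sup>n, 0)\<close>, fixing the origin.\<close>

definition biholomorphic_germ_at_0 :: "(complex ^ 'n \<Rightarrow> complex ^ 'n) \<Rightarrow> bool" where
  "biholomorphic_germ_at_0 h \<longleftrightarrow> h 0 = 0 \<and>
     (\<exists>S T g. open S \<and> open T \<and> 0 \<in> S \<and> homeomorphism S T h g \<and>
        holomorphic_map_on h S \<and> holomorphic_map_on g T)"

section \<open>Linearization and the polynomial family\<close>

definition diagonal_field :: "('n \<Rightarrow> complex) \<Rightarrow> complex ^ 'n \<Rightarrow> complex ^ 'n" where
  "diagonal_field lam w = (\<chi> j. lam j * w $ j)"

text \<open>
  The change of variables \<open>w = h z\<close> transforms \<open>z' = X z\<close> into \<open>w' = diagonal_field lam w\<close>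
  iff \<open>Dh(z) (X z) = diagonal_field lam (h z)\<close> near 0.
\<close>

definition linearizable_at_0 ::
    "('n \<Rightarrow> complex) \<Rightarrow> (complex ^ 'n \<Rightarrow> complex ^ 'n) \<Rightarrow> bool" where
  "linearizable_at_0 lam X \<longleftrightarrow>
     (\<exists>h. biholomorphic_germ_at_0 h \<and> (h has_derivative (\<lambda>v. v)) (at 0) \<and>
        (\<forall>\<^sub>F z in nhds 0. frechet_derivative h (at z) (X z) = diagonal_field lam (h z)))"

definition multi_indices :: "nat \<Rightarrow> nat \<Rightarrow> nat Matrix.vec set" where
  "multi_indices m d =
     {i \<in> carrier_vec m. 1 \<le> (\<Sum>k<m. vec_index i k) \<and> (\<Sum>k<m. vec_index i k) \<le> d}"

definition monomial_vec :: "nat \<Rightarrow> complex Matrix.vec \<Rightarrow> nat Matrix.vec \<Rightarrow> complex" where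
  "monomial_vec m t i = (\<Prod>k<m. vec_index t k ^ vec_index i k)"

definition polynomial_family ::
    "nat \<Rightarrow> nat \<Rightarrow> ('n \<Rightarrow> complex) \<Rightarrow> ('n \<Rightarrow> nat Matrix.vec \<Rightarrow> complex ^ 'n \<Rightarrow> complex) \<Rightarrow>
      complex Matrix.vec \<Rightarrow> complex ^ 'n \<Rightarrow> complex ^ 'n" where
  "polynomial_family m d lam f t z =
     (\<chi> j. lam j * z $ j + (\<Sum>i\<in>multi_indices m d. monomial_vec m t i * f j i z))"

text \<open>The sum above is a genuine finite sum.\<close>

lemma finite_multi_indices: "finite (multi_indices m d)"
proof (rule finite_subset)
  show "multi_indices m d \<subseteq> vec_of_list ` {xs. set xs \<subseteq> {..d} \<and> length xs = m}"
  proof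
    fix i assume i: "i \<in> multi_indices m d"
    have "vec_index i k \<le> d" if "k < m" for k
    proof -
      have "vec_index i k \<le> (\<Sum>k<m. vec_index i k)"
        using that by (intro member_le_sum) auto
      with i show ?thesis by (auto simp: multi_indices_def)
    qed
    with i have "set (list_of_vec i) \<subseteq> {..d}" "length (list_of_vec i) = m"
      by (auto simp: multi_indices_def in_set_conv_nth list_of_vec_index)
    moreover have "i = vec_of_list (list_of_vec i)" by (simp add: vec_list)
    ultimately show "i \<in> vec_of_list ` {xs. set xs \<subseteq> {..d} \<and> length xs = m}" by blast
  qed
  show "finite (vec_of_list ` {xs. set xs \<subseteq> {..d} \<and> length xs = m})"
    by (intro finite_imageI finite_lists_length_eq) auto
qed

definition non_resonant :: "('n::finite \<Rightarrow> complex) \<Rightarrow> bool" where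
  "non_resonant lam \<longleftrightarrow>
     (\<forall>\<nu> :: 'n \<Rightarrow> nat. (\<Sum>k\<in>UNIV. \<nu> k) \<ge> 2 \<longrightarrow>
        (\<forall>j. (\<Sum>k\<in>UNIV. of_nat (\<nu> k) * lam k) - lam j \<noteq> 0))"

section \<open>Logarithmic capacity\<close>

text \<open>The conventions are \<open>log 0 = -\<infinity>\<close> (whereas \<open>ln 0 = 0\<close>) and \<open>e\<^sup>-\<^sup>\<infinity> = 0\<close>.\<close>

definition log_ereal :: "real \<Rightarrow> ereal" where
  "log_ereal x = (if x = 0 then -\<infinity> else ereal (ln x))"

definition exp_ereal :: "ereal \<Rightarrow> ennreal" where
  "exp_ereal x = (case x of ereal r \<Rightarrow> ennreal (exp r) | PInfty \<Rightarrow> \<infinity> | MInfty \<Rightarrow> 0)"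

definition measure_support :: "'a::topological_space measure \<Rightarrow> 'a set" where
  "measure_support \<mu> = {x. \<forall>U. open U \<and> x \<in> U \<longrightarrow> emeasure \<mu> U > 0}"

text \<open>
  The integral of \<open>log |z - w|\<close>, as positive part minus negative part (\<open>e2ennreal\<close> truncates
  negative values to 0). When \<open>\<mu>\<close> is finite with compact support the positive part is finite,
  so that the difference is meaningful, possibly \<open>-\<infinity>\<close>.
\<close>

definition log_energy :: "complex measure \<Rightarrow> ereal" where
  "log_energy \<mu> =
     enn2ereal (\<integral>\<^sup>+z. (\<integral>\<^sup>+w. e2ennreal (log_ereal (cmod (z - w))) \<partial>\<mu>) \<partial>\<mu>) -
     enn2ereal (\<integral>\<^sup>+z. (\<integral>\<^sup>+w. e2ennreal (- log_ereal (cmod (z - w))) \<partial>\<mu>) \<partial>\<mu>)"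

definition compact_prob_measures :: "complex set \<Rightarrow> complex measure set" where
  "compact_prob_measures E =
     {\<mu>. sets \<mu> = sets borel \<and> prob_space \<mu> \<and>
         compact (measure_support \<mu>) \<and> measure_support \<mu> \<subseteq> E}"

text \<open>The supremum is taken in the extended nonnegative reals, so it is 0 when \<open>E\<close> is empty.\<close>

definition log_capacity :: "complex set \<Rightarrow> ennreal" where
  "log_capacity E = (SUP \<mu>\<in>compact_prob_measures E. exp_ereal (log_energy \<mu>))"

section \<open>\<open>\<Gamma>\<close>-capacity\<close>

text \<open>\<open>Gamma_slice k\<close> is the operator \<open>\<Gamma>\<close> from subsets of dimension \<open>k + 1\<close> to dimension \<open>k\<close>.\<close>

definition Gamma_slice :: "nat \<Rightarrow> complex Matrix.vec set \<Rightarrow> complex Matrix.vec set" where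
  "Gamma_slice k E =
     {z \<in> carrier_vec k. log_capacity {w. z @\<^sub>v vec_of_list [w] \<in> E} > 0}"

text \<open>The full composition from dimension \<open>m\<close> down to 1; dimension 0 is a dummy case.\<close>

fun Gamma_line :: "nat \<Rightarrow> complex Matrix.vec set \<Rightarrow> complex set" where
  "Gamma_line 0 E = {}"
| "Gamma_line (Suc 0) E = {w. vec_of_list [w] \<in> E}"
| "Gamma_line (Suc (Suc k)) E = Gamma_line (Suc k) (Gamma_slice (Suc k) E)"

definition unitary_mats :: "nat \<Rightarrow> complex mat set" where
  "unitary_mats m = {U \<in> carrier_mat m m. U * mat_adjoint U = 1\<^sub>m m \<and> mat_adjoint U * U = 1\<^sub>m m}"

definition Gamma_capacity :: "nat \<Rightarrow> complex Matrix.vec set \<Rightarrow> ennreal" where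
  "Gamma_capacity m E =
     (SUP U\<in>unitary_mats m. log_capacity (Gamma_line m ((\<lambda>t. U *\<^sub>v t) ` E)))"

end

theory Submission
  imports Defs "HOL-Complex_Analysis.Cauchy_Integral_Formula" "HOL-Real_Asymp.Real_Asymp"
    "HOL-Computational_Algebra.Fundamental_Theorem_Algebra"
begin

text \<open>
  By non-resonance there is a unique formal linearization tangent to the identity, and its Taylor
  coefficient of index \<open>\<kappa>\<close> is a polynomial in \<open>t\<close> of degree at most \<open>d|\<kappa>|\<close>. The field is
  linearizable at the parameter \<open>t\<close> iff these coefficients grow at most geometrically. If they do so
  on a set of positive capacity, then, by countable exhaustion, they do so uniformly on a
  compact set carrying a measure with bounded potential, and the Bernstein--Walsh inequality propagates the
  geometric bound to the whole complex line. Several parameters are treated one at a time, following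
  the inductive definition of the \<open>\<Gamma>\<close>-capacity.
\<close>

text \<open>The divisors \<open>(\<Sum>k\<in>UNIV. of_nat (\<kappa> k) * lam k) - lam j\<close> do
  not involve the parameter: however small, they rescale the coefficients and leave their degree in
  \<open>t\<close> alone. The obstacle is that nothing controls the coefficients a priori, so a
  bound can only be transported from some parameters to others. This is done by degree: when the
  bound at the index \<open>i\<close> is \<open>L ^ wt i\<close> and the degree is at most
  \<open>d * wt i\<close>, the loss in the Bernstein--Walsh inequality is itself a
  \<open>wt i\<close>-th power and goes into a new \<open>L\<close>. The conclusion is pointwise,
  with \<open>L\<close> depending arbitrarily on the parameter. Hence complex lines can be filled
  one at a time, without uniformity in the remaining coordinates, and unitary changes of coordinates
  preserve the property of the coefficients that matters, their degree along lines. The exceptional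
  set of the second alternative is exactly the set of linearizable parameters.\<close>

no_notation Infinite_Set_Sum.abs_summable_on (infix \<open>abs'_summable'_on\<close> 50)

section \<open>Power series in several variables\<close>

definition mdeg :: "('n::finite \<Rightarrow> nat) \<Rightarrow> nat" where
  "mdeg \<kappa> = (\<Sum>l\<in>UNIV. \<kappa> l)"

definition mono_at :: "complex ^ 'n \<Rightarrow> ('n::finite \<Rightarrow> nat) \<Rightarrow> complex" where
  "mono_at z \<kappa> = (\<Prod>l\<in>UNIV. z $ l ^ \<kappa> l)"

lemma mono_at_zero [simp]: "mono_at z (\<lambda>_. 0) = 1"
  by (simp add: mono_at_def)

lemma mdeg_zero [simp]: "mdeg (\<lambda>_. 0) = 0"
  by (simp add: mdeg_def)

lemma mdeg_eq_0_iff: "mdeg \<kappa> = 0 \<longleftrightarrow> \<kappa> = (\<lambda>_. 0)"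
  by (auto simp: mdeg_def fun_eq_iff)

lemma le_mdeg: "\<kappa> l \<le> mdeg \<kappa>"
  unfolding mdeg_def by (rule member_le_sum) auto

lemma mono_at_add: "mono_at z (\<lambda>l. \<alpha> l + \<beta> l) = mono_at z \<alpha> * mono_at z \<beta>"
  by (simp add: mono_at_def power_add prod.distrib)

lemma mdeg_add: "mdeg (\<lambda>l. \<alpha> l + \<beta> l) = mdeg \<alpha> + mdeg \<beta>"
  by (simp add: mdeg_def sum.distrib)

lemma mono_at_upd: "\<kappa> l = 0 \<Longrightarrow> mono_at z (\<kappa>(l := p)) = mono_at z \<kappa> * z $ l ^ p"
  by (simp add: mono_at_def prod.remove[of UNIV l])

text \<open>Sums stand on both sides because subtraction on \<open>nat\<close> truncates;
  \<open>p = 0\<close> splits off one exponent.\<close>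

lemma mdeg_upd: "mdeg (\<kappa>(l := p)) + \<kappa> l = mdeg \<kappa> + p"
  by (simp add: mdeg_def sum.remove[of UNIV l])

lemma norm_mono_at_le:
  assumes "\<And>l. cmod (z $ l) \<le> \<rho>"
  shows "cmod (mono_at z \<kappa>) \<le> \<rho> ^ mdeg \<kappa>"
proof -
  have "cmod (mono_at z \<kappa>) = (\<Prod>l\<in>UNIV. cmod (z $ l) ^ \<kappa> l)"
    by (simp add: mono_at_def prod_norm[symmetric] norm_power)
  also have "\<dots> \<le> (\<Prod>l\<in>UNIV. \<rho> ^ \<kappa> l)"
    using assms by (intro prod_mono) (auto intro: power_mono)
  also have "\<dots> = \<rho> ^ mdeg \<kappa>" by (simp add: mdeg_def power_sum)
  finally show ?thesis .
qed

text \<open>A finite set of indices lies in a box, over which the sum factors into one geometric sum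
  per variable, each at most \<open>1 / (1 - x)\<close>. The bound on finite partial sums is
  therefore uniform.\<close>

lemma summable_on_power_mdeg:
  assumes "0 \<le> x" "x < (1::real)"
  shows "(\<lambda>\<kappa> :: 'n::finite \<Rightarrow> nat. x ^ mdeg \<kappa>) summable_on A"
proof -
  have bd: "sum (\<lambda>\<kappa>. x ^ mdeg \<kappa>) F \<le> (1 / (1 - x)) ^ CARD('n)" if F: "finite F" for F :: "('n \<Rightarrow> nat) set"
  proof -
    define N where "N = Suc (\<Sum>\<kappa>\<in>F. mdeg \<kappa>)"
    have sub: "F \<subseteq> PiE (UNIV :: 'n set) (\<lambda>_. {..<N})"
    proof
      fix \<kappa> assume "\<kappa> \<in> F"
      then have "mdeg \<kappa> \<le> (\<Sum>\<kappa>\<in>F. mdeg \<kappa>)" using F by (intro member_le_sum) auto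
      then have "\<kappa> l < N" for l using le_mdeg[of \<kappa> l] by (simp add: N_def)
      then show "\<kappa> \<in> PiE (UNIV :: 'n set) (\<lambda>_. {..<N})" by auto
    qed
    have "sum (\<lambda>\<kappa>. x ^ mdeg \<kappa>) F \<le> sum (\<lambda>\<kappa>. x ^ mdeg \<kappa>) (PiE (UNIV :: 'n set) (\<lambda>_. {..<N}))"
      using assms sub by (intro sum_mono2 finite_PiE) auto
    also have "\<dots> = (\<Sum>\<kappa>\<in>PiE (UNIV :: 'n set) (\<lambda>_. {..<N}). \<Prod>l\<in>UNIV. x ^ \<kappa> l)"
      by (simp add: mdeg_def power_sum)
    also have "\<dots> = (\<Prod>l\<in>(UNIV::'n set). \<Sum>k<N. x ^ k)"
      by (subst prod_sum_PiE) auto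
    also have "\<dots> \<le> (\<Prod>l\<in>(UNIV::'n set). 1 / (1 - x))"
      using assms by (intro prod_mono) (auto simp: sum_nonneg sum_gp_strict power_le_one intro!: divide_right_mono divide_nonneg_pos)
    finally show ?thesis by simp
  qed
  show ?thesis
    using assms bd by (intro nonneg_bdd_above_summable_on bdd_aboveI2[where M = "(1 / (1 - x)) ^ CARD('n)"]) auto
qed

lemma abs_summable_on_power_series:
  fixes c :: "('n::finite \<Rightarrow> nat) \<Rightarrow> complex"
  assumes c: "\<And>\<kappa>. \<kappa> \<in> A \<Longrightarrow> cmod (c \<kappa>) \<le> C * R ^ mdeg \<kappa>" and z: "\<And>l. cmod (z $ l) \<le> \<rho>"
    and "0 \<le> C" "0 \<le> R" "R * \<rho> < 1" "0 \<le> \<rho>"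
  shows "(\<lambda>\<kappa>. c \<kappa> * mono_at z \<kappa>) abs_summable_on A"
proof (rule Infinite_Sum.abs_summable_on_comparison_test')
  show "(\<lambda>\<kappa>::'n\<Rightarrow>nat. C * (R * \<rho>) ^ mdeg \<kappa>) summable_on A"
    using assms by (intro summable_on_cmult_right summable_on_power_mdeg) auto
  show "norm (c \<kappa> * mono_at z \<kappa>) \<le> C * (R * \<rho>) ^ mdeg \<kappa>" if "\<kappa> \<in> A" for \<kappa>
  proof -
    have "norm (c \<kappa> * mono_at z \<kappa>) \<le> (C * R ^ mdeg \<kappa>) * \<rho> ^ mdeg \<kappa>"
      unfolding norm_mult by (intro mult_mono c norm_mono_at_le z that) (use assms in auto)
    then show ?thesis by (simp add: power_mult_distrib mult_ac)
  qed
qed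

lemma norm_le_sum_cmod_nth: "norm (z :: complex ^ 'n) \<le> (\<Sum>l\<in>UNIV. cmod (z $ l))"
  by (simp add: norm_vec_def L2_set_le_sum)

text \<open>Bridge between germs, taken in the Euclidean topology, and estimates by moduli of
  coordinates. The factor \<open>CARD('n)\<close> comes from bounding the norm by the sum of these
  moduli.\<close>

lemma eventually_nhds_0_polydisc:
  fixes P :: "complex ^ 'n \<Rightarrow> bool"
  shows "(\<forall>\<^sub>F z in nhds (0 :: complex ^ 'n). P z) \<longleftrightarrow> (\<exists>r>0. \<forall>z. (\<forall>l. cmod (z $ l) < r) \<longrightarrow> P z)"
proof
  assume "\<forall>\<^sub>F z in nhds (0 :: complex ^ 'n). P z"
  then obtain e where e: "e > 0" "\<And>z. norm z < e \<Longrightarrow> P z"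
    by (auto simp: eventually_nhds_metric dist_norm)
  show "\<exists>r>0. \<forall>z. (\<forall>l. cmod (z $ l) < r) \<longrightarrow> P z"
  proof (intro exI[of _ "e / CARD('n)"] conjI allI impI)
    fix z :: "complex ^ 'n" assume "\<forall>l. cmod (z $ l) < e / CARD('n)"
    then have "(\<Sum>l\<in>UNIV. cmod (z $ l)) < (\<Sum>l\<in>(UNIV::'n set). e / CARD('n))"
      by (intro sum_strict_mono) auto
    then show "P z" using e(2) norm_le_sum_cmod_nth[of z] by simp
  qed (use e in auto)
next
  assume "\<exists>r>0. \<forall>z. (\<forall>l. cmod (z $ l) < r) \<longrightarrow> P z"
  then obtain r where r: "r > 0" "\<And>z :: complex ^ 'n. (\<And>l. cmod (z $ l) < r) \<Longrightarrow> P z" by auto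
  have "P z" if "norm z < r" for z :: "complex ^ 'n"
    using Finite_Cartesian_Product.norm_nth_le[of z] that by (intro r(2)) (meson le_less_trans)
  then show "\<forall>\<^sub>F z in nhds (0 :: complex ^ 'n). P z"
    using r(1) by (auto simp: eventually_nhds_metric dist_norm)
qed

subsection \<open>Taylor expansion of bounded separately holomorphic functions\<close>

definition upd_vec :: "complex ^ 'n \<Rightarrow> 'n \<Rightarrow> complex \<Rightarrow> complex ^ 'n" where
  "upd_vec z l s = (\<chi> j. if j = l then s else z $ j)"

lemma upd_vec_nth: "upd_vec z l s $ j = (if j = l then s else z $ j)"
  by (simp add: upd_vec_def)

lemma upd_vec_same [simp]: "upd_vec (upd_vec z l s) l s' = upd_vec z l s'"
  by (simp add: Finite_Cartesian_Product.vec_eq_iff upd_vec_nth)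

lemma upd_vec_commute: "j \<noteq> l \<Longrightarrow> upd_vec (upd_vec z j s) l s' = upd_vec (upd_vec z l s') j s"
  by (auto simp: Finite_Cartesian_Product.vec_eq_iff upd_vec_nth)

lemma upd_vec_triv [simp]: "upd_vec z l (z $ l) = z"
  by (simp add: Finite_Cartesian_Product.vec_eq_iff upd_vec_nth)

definition polydisc :: "real \<Rightarrow> (complex ^ 'n) set" where
  "polydisc r = {z. \<forall>l. cmod (z $ l) < r}"

lemma open_polydisc: "open (polydisc r :: (complex ^ 'n) set)"
proof -
  have eq: "polydisc r = (\<Inter>l\<in>UNIV. {z :: complex ^ 'n. cmod (z $ l) < r})" by (auto simp: polydisc_def)
  show ?thesis unfolding eq by (intro open_INT ballI open_Collect_less continuous_intros) auto
qed

text \<open>This class is stable under taking a Taylor coefficient in one variable, at the price of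
  a factor \<open>(2 / r) ^ p\<close> in the bound. That is what an induction over the variables
  requires.\<close>

definition bdd_sep_holomorphic :: "real \<Rightarrow> real \<Rightarrow> (complex ^ 'n \<Rightarrow> complex) \<Rightarrow> bool" where
  "bdd_sep_holomorphic r M g \<longleftrightarrow>
     (\<forall>z\<in>polydisc r. cmod (g z) \<le> M \<and> (\<forall>l. (\<lambda>s. g (upd_vec z l s)) holomorphic_on ball 0 r))"

definition partial_taylor :: "(complex ^ 'n \<Rightarrow> complex) \<Rightarrow> 'n \<Rightarrow> nat \<Rightarrow> complex ^ 'n \<Rightarrow> complex" where
  "partial_taylor g l p z = (deriv ^^ p) (\<lambda>s. g (upd_vec z l s)) 0 / fact p"

lemma upd_vec_polydisc: "z \<in> polydisc r \<Longrightarrow> cmod s < r \<Longrightarrow> upd_vec z l s \<in> polydisc r"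
  by (auto simp: polydisc_def upd_vec_nth)

context
  fixes r M :: real and g :: "complex ^ 'n \<Rightarrow> complex" and l :: 'n
  assumes r: "r > 0" and g: "bdd_sep_holomorphic r M g"
begin

text \<open>Cauchy's inequality on the circle of radius \<open>r / 2\<close>: control is available
  on the open disc of radius \<open>r\<close> only, and the smaller closed disc costs the factor 2
  in the rate.\<close>

lemma partial_taylor_bound:
  assumes z: "z \<in> polydisc r"
  shows "cmod (partial_taylor g l p z) \<le> M * (2 / r) ^ p"
proof -
  let ?F = "\<lambda>s. g (upd_vec z l s)"
  have hol: "?F holomorphic_on ball 0 r" using g z by (auto simp: bdd_sep_holomorphic_def)
  have "norm ((deriv ^^ p) ?F 0) \<le> (fact p) * M / (r/2)^p"
  proof (rule Cauchy_inequality)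
    show "?F holomorphic_on ball 0 (r/2)" by (rule holomorphic_on_subset[OF hol]) (use r in auto)
    show "continuous_on (cball 0 (r/2)) ?F"
      by (rule holomorphic_on_imp_continuous_on, rule holomorphic_on_subset[OF hol]) (use r in auto)
    show "norm (?F x) \<le> M" if "norm (0 - x) = r/2" for x
      using g upd_vec_polydisc[OF z, of x l] that r by (auto simp: bdd_sep_holomorphic_def)
  qed (use r in auto)
  then show ?thesis
    using r by (simp add: partial_taylor_def norm_divide power_divide field_simps)
qed

lemma partial_taylor_sums:
  assumes z: "z \<in> polydisc r" and s: "cmod s < r"
  shows "(\<lambda>p. partial_taylor g l p z * s ^ p) sums g (upd_vec z l s)"
  using holomorphic_power_series[of "\<lambda>s. g (upd_vec z l s)" 0 r s] g z s
  by (auto simp: bdd_sep_holomorphic_def partial_taylor_def)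

text \<open>The \<open>p\<close>-th Taylor coefficient in one variable is a uniform limit, as \<open>s \<rightarrow> 0\<close>, of the quotients
  \<open>(g - (terms of degree < p)) / s\<^sup>p\<close>, hence holomorphic in the other variables.\<close>

lemma partial_taylor_quotient:
  assumes z: "z \<in> polydisc r"
  defines "\<sigma> \<equiv> \<lambda>n. of_real (r / 2 / (real n + 2))"
  shows "cmod ((g (upd_vec z l (\<sigma> n)) - (\<Sum>q<p. partial_taylor g l q z * \<sigma> n ^ q)) / \<sigma> n ^ p
            - partial_taylor g l p z) \<le> M * (2 / r) ^ p / (real n + 1)"
proof -
  have s: "cmod (\<sigma> n) = r / 2 / (real n + 2)" using r by (simp add: \<sigma>_def norm_divide del: of_real_divide)
  have s0: "\<sigma> n \<noteq> 0" using s r by auto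
  have s1: "cmod (\<sigma> n) < r" unfolding s using r by (intro le_less_trans[OF divide_left_mono[of 1 "real n + 2" "r / 2"]]) auto
  let ?a = "\<lambda>p. partial_taylor g l p z"
  \<comment> \<open>The bound \<open>M * (2 / r) ^ q\<close> against the \<open>q\<close>-th power
    of the modulus of \<open>\<sigma> n\<close> leaves the ratio \<open>x\<close>. The geometric
    tail \<open>x / (1 - x)\<close> then equals \<open>1 / (n + 1)\<close>, which is why
    \<open>\<sigma> n\<close> has the denominator \<open>n + 2\<close>.\<close>
  define x where "x = 1 / (real n + 2)"
  have x: "0 < x" "x < 1" by (auto simp: x_def)
  have "(\<lambda>q. ?a (q + Suc p) * \<sigma> n ^ (q + Suc p)) sums (g (upd_vec z l (\<sigma> n)) - (\<Sum>q<Suc p. ?a q * \<sigma> n ^ q))"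
    by (rule sums_split_initial_segment[OF partial_taylor_sums[OF z s1]])
  then have "(\<lambda>q. ?a (q + Suc p) * \<sigma> n ^ (q + Suc p) / \<sigma> n ^ p) sums
      ((g (upd_vec z l (\<sigma> n)) - (\<Sum>q<Suc p. ?a q * \<sigma> n ^ q)) / \<sigma> n ^ p)"
    by (rule sums_divide)
  moreover have "?a (q + Suc p) * \<sigma> n ^ (q + Suc p) / \<sigma> n ^ p = ?a (q + Suc p) * \<sigma> n ^ Suc q" for q
    using s0 by (simp add: power_add)
  moreover have "(g (upd_vec z l (\<sigma> n)) - (\<Sum>q<Suc p. ?a q * \<sigma> n ^ q)) / \<sigma> n ^ p
      = (g (upd_vec z l (\<sigma> n)) - (\<Sum>q<p. ?a q * \<sigma> n ^ q)) / \<sigma> n ^ p - ?a p"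
    using s0 by (simp add: diff_divide_distrib add_divide_distrib)
  ultimately have sm: "(\<lambda>q. ?a (q + Suc p) * \<sigma> n ^ Suc q) sums
      ((g (upd_vec z l (\<sigma> n)) - (\<Sum>q<p. ?a q * \<sigma> n ^ q)) / \<sigma> n ^ p - ?a p)"
    by simp
  have le: "norm (?a (q + Suc p) * \<sigma> n ^ Suc q) \<le> M * (2 / r) ^ p * x * x ^ q" for q
  proof -
    have "norm (?a (q + Suc p) * \<sigma> n ^ Suc q) \<le> M * (2 / r) ^ (q + Suc p) * (r / 2 * x) ^ Suc q"
      unfolding norm_mult norm_power s
      using partial_taylor_bound[OF z, of "q + Suc p"] r x
      by (intro mult_mono) (auto simp: x_def intro: order_trans[OF norm_ge_zero])
    also have "\<dots> = M * (2 / r) ^ p * ((2 / r) * (r / 2 * x)) ^ Suc q"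
      unfolding power_mult_distrib power_add by (simp add: mult_ac power_mult_distrib)
    also have "(2 / r) * (r / 2 * x) = x" using r by simp
    finally show ?thesis by (simp add: mult_ac)
  qed
  have gs: "(\<lambda>q. M * (2 / r) ^ p * x * x ^ q) sums (M * (2 / r) ^ p * x * (1 / (1 - x)))"
    using x by (intro sums_mult geometric_sums) auto
  have "norm (suminf (\<lambda>q. ?a (q + Suc p) * \<sigma> n ^ Suc q)) \<le> suminf (\<lambda>q. M * (2 / r) ^ p * x * x ^ q)"
    by (rule norm_suminf_le) (use le gs in \<open>auto simp: sums_iff\<close>)
  also have "\<dots> = M * (2 / r) ^ p * (x * (1 / (1 - x)))" using gs by (simp add: sums_iff)
  also have "x * (1 / (1 - x)) = 1 / (real n + 1)" by (simp add: x_def divide_simps)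
  finally show ?thesis using sm by (simp add: sums_iff)
qed

lemma bdd_sep_holomorphic_partial_taylor:
  "bdd_sep_holomorphic r (M * (2 / r) ^ p) (partial_taylor g l p)"
proof -
  have "(\<lambda>s. partial_taylor g l p (upd_vec z j s)) holomorphic_on ball 0 r"
    if z: "z \<in> polydisc r" for z j
  proof (cases "j = l")
    case True
    then show ?thesis by (simp add: partial_taylor_def)
  next
    case False
    show ?thesis
    \<comment> \<open>Strong induction, because the quotient \<open>G n\<close> contains the
      coefficients of order below \<open>p\<close>, whose holomorphy in the variable
      \<open>j\<close> must already be known.\<close>
    proof (induction p rule: less_induct)
      case (less p)
      define \<sigma> :: "nat \<Rightarrow> complex" where "\<sigma> = (\<lambda>n. of_real (r / 2 / (real n + 2)))"
      have s1: "cmod (\<sigma> n) < r" "\<sigma> n \<noteq> 0" for n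
        using r le_less_trans[OF divide_left_mono[of 1 "real n + 2" "r / 2"], of r]
        by (auto simp: \<sigma>_def norm_divide simp del: of_real_divide)
      define G where "G = (\<lambda>n s. (g (upd_vec (upd_vec z j s) l (\<sigma> n))
          - (\<Sum>q<p. partial_taylor g l q (upd_vec z j s) * \<sigma> n ^ q)) / \<sigma> n ^ p)"
      let ?a = "\<lambda>s. partial_taylor g l p (upd_vec z j s)"
      have G: "G n holomorphic_on ball 0 r" for n
        unfolding G_def upd_vec_commute[OF False] using s1 less upd_vec_polydisc[OF z s1(1)] g
        by (intro holomorphic_intros) (auto simp: bdd_sep_holomorphic_def)
      have near: "dist (G n s) (?a s) \<le> M * (2 / r) ^ p / (real n + 1)" if "s \<in> ball 0 r" for n s
        using partial_taylor_quotient[OF upd_vec_polydisc[OF z, of s j], of n p] that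
        by (simp add: G_def \<sigma>_def dist_norm)
      have "uniform_limit (ball 0 r) G ?a sequentially"
      proof (rule uniform_limitI)
        fix e :: real assume "e > 0"
        have "(\<lambda>n. M * (2 / r) ^ p / (real n + 1)) \<longlonglongrightarrow> 0" by real_asymp
        then have "\<forall>\<^sub>F n in sequentially. M * (2 / r) ^ p / (real n + 1) < e"
          using \<open>e > 0\<close> by (rule order_tendstoD)
        then show "\<forall>\<^sub>F n in sequentially. \<forall>s\<in>ball 0 r. dist (G n s) (?a s) < e"
          by eventually_elim (auto intro: le_less_trans near)
      qed
      then have "\<exists>d>0. cball s d \<subseteq> ball 0 r \<and> uniform_limit (cball s d) G ?a sequentially"
        if "s \<in> ball 0 r" for s
        using that open_ball[of 0 r] unfolding open_contains_cball by (blast intro: uniform_limit_on_subset)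
      then show ?case by (rule holomorphic_uniform_sequence[OF open_ball G])
    qed
  qed
  then show ?thesis
    by (auto simp: bdd_sep_holomorphic_def intro: partial_taylor_bound)
qed

end

text \<open>Induction on the set \<open>S\<close> of variables on which \<open>g\<close> depends.
  Expanding in one variable \<open>l\<close> gives coefficient functions of the others. Each
  variable contributes its own power of \<open>2 / r\<close>, so the rate stays \<open>2 / r\<close>
  in the total degree and the series converges on \<open>polydisc (r / 2)\<close>.\<close>

lemma power_series_expansion_aux:
  fixes S :: "'n::finite set" and r :: real and g :: "complex ^ 'n \<Rightarrow> complex"
  assumes "finite S" and r: "r > 0"
  shows "bdd_sep_holomorphic r M g \<Longrightarrow> (\<And>z z'. (\<forall>l\<in>S. z $ l = z' $ l) \<Longrightarrow> g z = g z') \<Longrightarrow>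
     \<exists>c. (\<forall>\<kappa>. cmod (c \<kappa>) \<le> M * (2 / r) ^ mdeg \<kappa>) \<and>
       (\<forall>z\<in>polydisc (r / 2). ((\<lambda>\<kappa>. c \<kappa> * mono_at z \<kappa>) has_sum g z) {\<kappa>. \<forall>j. j \<notin> S \<longrightarrow> \<kappa> j = 0})"
  using assms(1)
proof (induction S arbitrary: g M)
  case empty
  have eq: "{\<kappa>. \<forall>j. j \<notin> {} \<longrightarrow> \<kappa> j = 0} = {\<lambda>_::'n. 0::nat}" by auto
  have g: "g z = g 0" for z using empty(2) by auto
  have b: "cmod (g 0) \<le> M" using empty(1) r by (auto simp: bdd_sep_holomorphic_def polydisc_def)
  show ?case
  proof (intro exI[of _ "\<lambda>\<kappa>. if mdeg \<kappa> = 0 then g 0 else 0"] conjI allI ballI)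
    show "cmod (if mdeg \<kappa> = 0 then g 0 else 0) \<le> M * (2 / r) ^ mdeg \<kappa>" for \<kappa> :: "'n \<Rightarrow> nat"
      using b r order_trans[OF norm_ge_zero b] by auto
  next
    fix z :: "complex ^ 'n" assume "z \<in> polydisc (r / 2)"
    show "((\<lambda>\<kappa>. (if mdeg \<kappa> = 0 then g 0 else 0) * mono_at z \<kappa>) has_sum g z) {\<kappa>. \<forall>j. j \<notin> {} \<longrightarrow> \<kappa> j = 0}"
      unfolding eq by (rule has_sum_finiteI) (auto simp: g[of z])
  qed
next
  case (insert l S)
  note g = insert.prems(1)
  have "cmod (g 0) \<le> M" using g r by (auto simp: bdd_sep_holomorphic_def polydisc_def)
  then have M: "M \<ge> 0" using norm_ge_zero order_trans by blast
  define Q where "Q p c \<longleftrightarrow> (\<forall>\<kappa>. cmod (c \<kappa>) \<le> (M * (2 / r) ^ p) * (2 / r) ^ mdeg \<kappa>) \<and>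
       (\<forall>z\<in>polydisc (r / 2). ((\<lambda>\<kappa>. c \<kappa> * mono_at z \<kappa>) has_sum partial_taylor g l p z)
         {\<kappa>. \<forall>j. j \<notin> S \<longrightarrow> \<kappa> j = 0})" for p c
  have "\<exists>c. Q p c" for p
    unfolding Q_def
  proof (rule insert.IH)
    show "bdd_sep_holomorphic r (M * (2 / r) ^ p) (partial_taylor g l p)"
      by (rule bdd_sep_holomorphic_partial_taylor[OF r g])
    \<comment> \<open>\<open>partial_taylor g l p\<close> overwrites the coordinate
      \<open>l\<close>, so it depends on the coordinates in \<open>S\<close> alone.\<close>
    fix z z' :: "complex ^ 'n" assume "\<forall>l\<in>S. z $ l = z' $ l"
    then have "g (upd_vec z l s) = g (upd_vec z' l s)" for s
      by (intro insert.prems(2)) (auto simp: upd_vec_nth)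
    then show "partial_taylor g l p z = partial_taylor g l p z'"
      by (simp add: partial_taylor_def)
  qed
  then obtain C where C0: "\<And>p. Q p (C p)" by metis
  have C: "cmod (C p \<kappa>) \<le> (M * (2 / r) ^ p) * (2 / r) ^ mdeg \<kappa>"
    "z\<in>polydisc (r / 2) \<Longrightarrow> ((\<lambda>\<kappa>. C p \<kappa> * mono_at z \<kappa>) has_sum partial_taylor g l p z)
         {\<kappa>. \<forall>j. j \<notin> S \<longrightarrow> \<kappa> j = 0}" for p \<kappa> z
    using C0[of p] by (auto simp: Q_def)
  define c where "c = (\<lambda>\<kappa>. C (\<kappa> l) (\<kappa>(l := 0)))"
  have c: "cmod (c \<kappa>) \<le> M * (2 / r) ^ mdeg \<kappa>" for \<kappa>
  proof -
    have eq: "mdeg \<kappa> = \<kappa> l + mdeg (\<kappa>(l := 0))" using mdeg_upd[of \<kappa> l 0] by simp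
    show ?thesis using C(1)[of "\<kappa> l" "\<kappa>(l := 0)"] unfolding eq c_def power_add mult.assoc .
  qed
  let ?A = "{\<kappa> :: 'n \<Rightarrow> nat. \<forall>j. j \<notin> S \<longrightarrow> \<kappa> j = 0}"
  let ?B = "{\<kappa> :: 'n \<Rightarrow> nat. \<forall>j. j \<notin> insert l S \<longrightarrow> \<kappa> j = 0}"
  have "((\<lambda>\<kappa>. c \<kappa> * mono_at z \<kappa>) has_sum g z) ?B" if z: "z \<in> polydisc (r / 2)" for z
  proof -
    have "r / 2 < r" using r by simp
    then have z': "z \<in> polydisc r" using z unfolding polydisc_def by (blast intro: less_trans)
    \<comment> \<open>The maximum merges the strict inequalities for the coordinates into one number
      with \<open>(2 / r) * \<rho> < 1\<close>.\<close>
    define \<rho> where "\<rho> = Max (range (\<lambda>j. cmod (z $ j)))"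
    have \<rho>: "cmod (z $ j) \<le> \<rho>" for j unfolding \<rho>_def by (rule Max_ge) auto
    have "\<rho> \<in> range (\<lambda>j. cmod (z $ j))" unfolding \<rho>_def by (rule Max_in) auto
    then have "\<rho> < r / 2" using z by (auto simp: polydisc_def)
    moreover have "0 \<le> \<rho>" using \<rho> norm_ge_zero order_trans by blast
    ultimately have abs: "(\<lambda>\<kappa>. c \<kappa> * mono_at z \<kappa>) abs_summable_on ?B"
      using r by (intro abs_summable_on_power_series[OF c \<rho> M]) (auto simp: divide_simps)
    then have sumB: "(\<lambda>\<kappa>. c \<kappa> * mono_at z \<kappa>) summable_on ?B" by (rule abs_summable_summable)
    \<comment> \<open>Separating the exponent \<open>p = \<kappa> l\<close> from the rest turns the
      multiple series into a double sum. Its inner sums are the expansions of the coefficients given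
      by the induction hypothesis, its outer sum is the Taylor series in \<open>z $ l\<close>.
      Summability over the product justifies the iterated evaluation.\<close>
    let ?h = "\<lambda>(p, \<kappa>). C p \<kappa> * mono_at z \<kappa> * z $ l ^ p"
    have key: "mono_at z (\<kappa>(l := 0)) * z $ l ^ \<kappa> l = mono_at z \<kappa>" for \<kappa>
      using mono_at_upd[of "\<kappa>(l := 0)" l z "\<kappa> l"] by simp
    have iff1: "(\<lambda>\<kappa>. c \<kappa> * mono_at z \<kappa>) summable_on ?B \<longleftrightarrow> ?h summable_on (UNIV \<times> ?A)"
      by (rule summable_on_reindex_bij_witness[where i = "\<lambda>(p, \<kappa>). \<kappa>(l := p)" and j = "\<lambda>\<kappa>. (\<kappa> l, \<kappa>(l := 0))"])
        (use insert.hyps(2) key in \<open>auto simp: c_def fun_eq_iff mult.assoc\<close>)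
    have iff2: "((\<lambda>\<kappa>. c \<kappa> * mono_at z \<kappa>) has_sum x) ?B \<longleftrightarrow> (?h has_sum x) (UNIV \<times> ?A)" for x
      by (rule has_sum_reindex_bij_witness[where i = "\<lambda>(p, \<kappa>). \<kappa>(l := p)" and j = "\<lambda>\<kappa>. (\<kappa> l, \<kappa>(l := 0))"])
        (use insert.hyps(2) key in \<open>auto simp: c_def fun_eq_iff mult.assoc\<close>)
    have sumh: "?h summable_on (UNIV \<times> ?A)" using sumB iff1 by simp
    have "(?h has_sum (\<Sum>\<^sub>\<infinity>x\<in>UNIV \<times> ?A. ?h x)) (UNIV \<times> ?A)" using sumh by simp
    then have "((\<lambda>p. partial_taylor g l p z * z $ l ^ p) has_sum (\<Sum>\<^sub>\<infinity>x\<in>UNIV \<times> ?A. ?h x)) UNIV"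
      by (rule has_sum_SigmaD) (use has_sum_cmult_left[OF C(2)[OF z]] in auto)
    then have "(\<lambda>p. partial_taylor g l p z * z $ l ^ p) sums (\<Sum>\<^sub>\<infinity>x\<in>UNIV \<times> ?A. ?h x)"
      by (rule has_sum_imp_sums)
    moreover have "(\<lambda>p. partial_taylor g l p z * z $ l ^ p) sums g z"
      using partial_taylor_sums[OF r g z', of "z $ l" l] z' by (simp add: polydisc_def)
    ultimately have "(\<Sum>\<^sub>\<infinity>x\<in>UNIV \<times> ?A. ?h x) = g z" by (rule sums_unique2)
    then show ?thesis using has_sum_infsum[OF sumh] iff2[of "g z"] by simp
  qed
  then show ?case using c by (intro exI[of _ c]) simp
qed

subsection \<open>Convergent power series and their algebra\<close>

text \<open>One number serves as constant and as rate, so that convergence has the form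
  \<open>L ^ wt\<close> of \<open>geometric_set\<close>; the \<open>Suc\<close> lets the constant
  term be large as well.\<close>

definition conv_series :: "(('n::finite \<Rightarrow> nat) \<Rightarrow> complex) \<Rightarrow> bool" where
  "conv_series c \<longleftrightarrow> (\<exists>L. \<forall>\<kappa>. cmod (c \<kappa>) \<le> L ^ Suc (mdeg \<kappa>))"

text \<open>Where the family is not summable, \<open>infsum\<close> gives 0; the identities between
  sums and products of series are therefore claimed near 0 only.\<close>

definition pseries :: "(('n::finite \<Rightarrow> nat) \<Rightarrow> complex) \<Rightarrow> complex ^ 'n \<Rightarrow> complex" where
  "pseries c z = (\<Sum>\<^sub>\<infinity>\<kappa>. c \<kappa> * mono_at z \<kappa>)"

lemma conv_seriesI:
  assumes "\<And>\<kappa>. cmod (c \<kappa>) \<le> C * R ^ mdeg \<kappa>"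
  shows "conv_series c"
  unfolding conv_series_def
proof (intro exI allI)
  fix \<kappa>
  have "cmod (c \<kappa>) \<le> \<bar>C\<bar> * \<bar>R\<bar> ^ mdeg \<kappa>"
    by (rule order_trans[OF assms], rule order_trans[OF abs_ge_self]) (simp add: abs_mult power_abs)
  also have "\<dots> \<le> max \<bar>C\<bar> \<bar>R\<bar> * max \<bar>C\<bar> \<bar>R\<bar> ^ mdeg \<kappa>"
    by (intro mult_mono power_mono) auto
  finally show "cmod (c \<kappa>) \<le> max \<bar>C\<bar> \<bar>R\<bar> ^ Suc (mdeg \<kappa>)" by simp
qed

lemma conv_seriesE:
  assumes "conv_series c"
  obtains L where "L \<ge> 1" "\<And>\<kappa>. cmod (c \<kappa>) \<le> L * L ^ mdeg \<kappa>"
proof -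
  obtain L where L: "\<And>\<kappa>. cmod (c \<kappa>) \<le> L ^ Suc (mdeg \<kappa>)"
    using assms unfolding conv_series_def by auto
  show ?thesis
  proof (rule that[of "max 1 \<bar>L\<bar>"])
    fix \<kappa>
    have "cmod (c \<kappa>) \<le> \<bar>L\<bar> ^ Suc (mdeg \<kappa>)"
      by (rule order_trans[OF L], rule order_trans[OF abs_ge_self]) (simp add: abs_mult power_abs)
    also have "\<dots> \<le> max 1 \<bar>L\<bar> ^ Suc (mdeg \<kappa>)" by (intro power_mono) auto
    finally show "cmod (c \<kappa>) \<le> max 1 \<bar>L\<bar> * max 1 \<bar>L\<bar> ^ mdeg \<kappa>" by simp
  qed auto
qed

lemma conv_series_abs_summable:
  assumes "conv_series c"
  shows "\<forall>\<^sub>F z in nhds 0. (\<lambda>\<kappa>. c \<kappa> * mono_at z \<kappa>) abs_summable_on UNIV"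
proof -
  obtain L where L: "L \<ge> 1" "\<And>\<kappa>. cmod (c \<kappa>) \<le> L * L ^ mdeg \<kappa>"
    by (rule conv_seriesE[OF assms]) blast
  show ?thesis
    unfolding eventually_nhds_0_polydisc
  proof (intro exI[of _ "1 / (2 * L)"] conjI allI impI)
    fix z :: "complex ^ 'a" assume "\<forall>l. cmod (z $ l) < 1 / (2 * L)"
    then show "(\<lambda>\<kappa>. c \<kappa> * mono_at z \<kappa>) abs_summable_on UNIV"
      using L(1) by (intro abs_summable_on_power_series[OF L(2), where \<rho> = "1 / (2 * L)"]) (auto intro: less_imp_le)
  qed (use L(1) in auto)
qed

lemma conv_series_has_sum:
  assumes "conv_series c"
  shows "\<forall>\<^sub>F z in nhds 0. ((\<lambda>\<kappa>. c \<kappa> * mono_at z \<kappa>) has_sum pseries c z) UNIV"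
  using conv_series_abs_summable[OF assms]
  by eventually_elim (auto simp: pseries_def dest: abs_summable_summable)

lemma bounded_linear_axis: "bounded_linear (axis l :: complex \<Rightarrow> complex ^ 'n)"
  unfolding linear_conv_bounded_linear[symmetric]
  by (rule linearI) (auto simp: Finite_Cartesian_Product.vec_eq_iff axis_def)

lemma axis_eq_smult: "axis l h = h *s axis l (1 :: complex)"
  by (auto simp: Finite_Cartesian_Product.vec_eq_iff axis_def)

text \<open>Complex-linear differentiability supplies both parts of
  \<open>bdd_sep_holomorphic\<close>: continuity at 0 bounds \<open>g\<close> on a small polydisc,
  and composing the derivative with \<open>axis l\<close> gives a complex derivative in each
  variable.\<close>

lemma holomorphic_germ_power_series:
  fixes g :: "complex ^ 'n \<Rightarrow> complex"
  assumes "holomorphic_germ_at_0 g"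
  shows "\<exists>c. conv_series c \<and> (\<forall>\<^sub>F z in nhds 0. g z = pseries c z)"
proof -
  obtain S where S: "open S" "0 \<in> S" "holomorphic_several_on g S"
    using assms by (auto simp: holomorphic_germ_at_0_def)
  obtain D where "(g has_derivative D) (at 0)" using S by (auto simp: holomorphic_several_on_def)
  then have "isCont g 0" by (rule has_derivative_continuous)
  then have "(g \<longlongrightarrow> g 0) (nhds 0)" unfolding isCont_def tendsto_at_iff_tendsto_nhds .
  then have "((\<lambda>z. cmod (g z)) \<longlongrightarrow> cmod (g 0)) (nhds 0)" by (rule tendsto_norm)
  then have "\<forall>\<^sub>F z in nhds 0. cmod (g z) < cmod (g 0) + 1" by (rule order_tendstoD) simp
  moreover have "\<forall>\<^sub>F z in nhds 0. z \<in> S" using S by (simp add: eventually_nhds_in_open)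
  ultimately have "\<forall>\<^sub>F z in nhds 0. cmod (g z) < cmod (g 0) + 1 \<and> z \<in> S" by (rule eventually_conj)
  then obtain r where r: "r > 0" "\<And>z. z \<in> polydisc r \<Longrightarrow> cmod (g z) < cmod (g 0) + 1 \<and> z \<in> S"
    unfolding eventually_nhds_0_polydisc polydisc_def by blast
  have hol: "(\<lambda>s. g (upd_vec z l s)) holomorphic_on ball 0 r" if z: "z \<in> polydisc r" for z l
    unfolding holomorphic_on_open[OF open_ball]
  proof
    fix s assume "s \<in> ball (0::complex) r"
    then have "upd_vec z l s \<in> S" using r(2) upd_vec_polydisc[OF z, of s l] by auto
    then obtain D where D: "(g has_derivative D) (at (upd_vec z l s))" "\<And>c v. D (c *s v) = c * D v"
      using S(3) by (auto simp: holomorphic_several_on_def)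
    define z0 where "z0 = upd_vec z l 0"
    have eq: "upd_vec z l = (\<lambda>s. z0 + axis l s)"
      by (auto simp: z0_def fun_eq_iff Finite_Cartesian_Product.vec_eq_iff upd_vec_nth axis_def)
    have "((\<lambda>s. z0 + axis l s) has_derivative (\<lambda>h. 0 + axis l h)) (at s)"
      by (intro has_derivative_add has_derivative_const bounded_linear.has_derivative[OF bounded_linear_axis has_derivative_ident])
    then have "(upd_vec z l has_derivative axis l) (at s)" unfolding eq by simp
    from has_derivative_compose[OF this D(1)]
    have "((\<lambda>s. g (upd_vec z l s)) has_derivative (\<lambda>h. D (axis l h))) (at s)" .
    moreover have "(\<lambda>h. D (axis l h)) = (*) (D (axis l 1))"
      by (rule ext, subst axis_eq_smult) (simp add: D(2))
    ultimately show "\<exists>f'. ((\<lambda>s. g (upd_vec z l s)) has_field_derivative f') (at s)"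
      unfolding has_field_derivative_def by metis
  qed
  have g: "bdd_sep_holomorphic r (cmod (g 0) + 1) g"
    unfolding bdd_sep_holomorphic_def using r(2) hol by (auto intro: less_imp_le)
  obtain c where c: "\<And>\<kappa>. cmod (c \<kappa>) \<le> (cmod (g 0) + 1) * (2 / r) ^ mdeg \<kappa>"
    "\<And>z. z \<in> polydisc (r / 2) \<Longrightarrow> ((\<lambda>\<kappa>. c \<kappa> * mono_at z \<kappa>) has_sum g z) UNIV"
    using power_series_expansion_aux[OF finite[of UNIV] r(1) g] by (auto simp: Finite_Cartesian_Product.vec_eq_iff[symmetric])
  have "\<forall>\<^sub>F z in nhds 0. g z = pseries c z"
    unfolding eventually_nhds_0_polydisc
    using r(1) c(2) by (intro exI[of _ "r / 2"]) (auto simp: polydisc_def pseries_def intro!: infsumI[symmetric])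
  then show ?thesis using conv_seriesI[OF c(1)] by blast
qed

lemma conv_series_add:
  assumes "conv_series a" "conv_series b"
  shows "conv_series (\<lambda>\<kappa>. a \<kappa> + b \<kappa>)"
    and "\<forall>\<^sub>F z in nhds 0. pseries (\<lambda>\<kappa>. a \<kappa> + b \<kappa>) z = pseries a z + pseries b z"
proof -
  obtain L where L: "L \<ge> 1" "\<And>\<kappa>. cmod (a \<kappa>) \<le> L * L ^ mdeg \<kappa>" by (rule conv_seriesE[OF assms(1)]) blast
  obtain M where M: "M \<ge> 1" "\<And>\<kappa>. cmod (b \<kappa>) \<le> M * M ^ mdeg \<kappa>" by (rule conv_seriesE[OF assms(2)]) blast
  show "conv_series (\<lambda>\<kappa>. a \<kappa> + b \<kappa>)"
  proof (rule conv_seriesI)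
    fix \<kappa>
    have "cmod (a \<kappa> + b \<kappa>) \<le> L * L ^ mdeg \<kappa> + M * M ^ mdeg \<kappa>"
      by (rule norm_triangle_le[OF add_mono[OF L(2) M(2)]])
    also have "\<dots> \<le> L * max L M ^ mdeg \<kappa> + M * max L M ^ mdeg \<kappa>"
      using L(1) M(1) by (intro add_mono mult_left_mono power_mono) auto
    finally show "cmod (a \<kappa> + b \<kappa>) \<le> (L + M) * max L M ^ mdeg \<kappa>" by (simp add: algebra_simps)
  qed
  show "\<forall>\<^sub>F z in nhds 0. pseries (\<lambda>\<kappa>. a \<kappa> + b \<kappa>) z = pseries a z + pseries b z"
    using conv_series_has_sum[OF assms(1)] conv_series_has_sum[OF assms(2)]
  proof eventually_elim
    case (elim z)
    from has_sum_add[OF this] show ?case by (simp add: pseries_def algebra_simps infsumI)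
  qed
qed

lemma conv_series_cmult:
  assumes "conv_series a"
  shows "conv_series (\<lambda>\<kappa>. k * a \<kappa>)" and "pseries (\<lambda>\<kappa>. k * a \<kappa>) z = k * pseries a z"
proof -
  obtain L where L: "L \<ge> 1" "\<And>\<kappa>. cmod (a \<kappa>) \<le> L * L ^ mdeg \<kappa>" by (rule conv_seriesE[OF assms]) blast
  show "conv_series (\<lambda>\<kappa>. k * a \<kappa>)"
    by (rule conv_seriesI[where C = "cmod k * L" and R = L]) (simp add: norm_mult mult.assoc mult_left_mono L(2))
  show "pseries (\<lambda>\<kappa>. k * a \<kappa>) z = k * pseries a z"
    by (simp add: pseries_def mult.assoc infsum_cmult_right')
qed

lemma conv_series_zero: "conv_series (\<lambda>_. 0)" and pseries_zero: "pseries (\<lambda>_. 0) z = 0"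
  by (auto simp: pseries_def intro: conv_seriesI[where C = 0])

lemma conv_series_sum:
  assumes "finite I" "\<And>i. i \<in> I \<Longrightarrow> conv_series (c i)"
  shows "conv_series (\<lambda>\<kappa>. \<Sum>i\<in>I. c i \<kappa>) \<and>
    (\<forall>\<^sub>F z in nhds 0. pseries (\<lambda>\<kappa>. \<Sum>i\<in>I. c i \<kappa>) z = (\<Sum>i\<in>I. pseries (c i) z))"
  using assms
proof (induction I)
  case empty
  then show ?case by (simp add: conv_series_zero pseries_zero)
next
  case (insert i I)
  then have "conv_series (c i)" "conv_series (\<lambda>\<kappa>. \<Sum>i\<in>I. c i \<kappa>)"
    "\<forall>\<^sub>F z in nhds 0. pseries (\<lambda>\<kappa>. \<Sum>i\<in>I. c i \<kappa>) z = (\<Sum>i\<in>I. pseries (c i) z)" by auto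
  with conv_series_add[OF this(1,2)] insert.hyps show ?case
    by (auto elim: eventually_elim2)
qed

section \<open>Cauchy products of power series\<close>

definition cauchy_prod :: "(('n::finite \<Rightarrow> nat) \<Rightarrow> complex) \<Rightarrow> (('n \<Rightarrow> nat) \<Rightarrow> complex) \<Rightarrow> ('n \<Rightarrow> nat) \<Rightarrow> complex" where
  "cauchy_prod a b \<kappa> = (\<Sum>\<alpha>\<in>{\<alpha>. \<forall>l. \<alpha> l \<le> \<kappa> l}. a \<alpha> * b (\<lambda>l. \<kappa> l - \<alpha> l))"

lemma below_eq_PiE: "{\<alpha>. \<forall>l. \<alpha> l \<le> \<kappa> l} = PiE UNIV (\<lambda>l::'n. {..\<kappa> l})" for \<kappa> :: "'n::finite \<Rightarrow> nat"
  by (auto simp: PiE_def)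

lemma finite_below [simp]: "finite {\<alpha>. \<forall>l. \<alpha> l \<le> \<kappa> l}" for \<kappa> :: "'n::finite \<Rightarrow> nat"
  unfolding below_eq_PiE by (rule finite_PiE) auto

lemma Suc_le_power2: "Suc k \<le> 2 ^ k"
  by (induction k) auto

text \<open>The number of terms in a coefficient of a Cauchy product is thus absorbed by doubling
  the geometric rate.\<close>

lemma card_below: "card {\<alpha>. \<forall>l. \<alpha> l \<le> \<kappa> l} \<le> 2 ^ mdeg \<kappa>" for \<kappa> :: "'n::finite \<Rightarrow> nat"
proof -
  have "card {\<alpha>. \<forall>l. \<alpha> l \<le> \<kappa> l} = (\<Prod>l\<in>UNIV. Suc (\<kappa> l))"
    unfolding below_eq_PiE by (subst card_PiE) auto
  also have "\<dots> \<le> (\<Prod>l\<in>UNIV. 2 ^ \<kappa> l)" by (intro prod_mono) (auto intro: Suc_le_power2)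
  finally show ?thesis by (simp add: mdeg_def power_sum)
qed

lemma mdeg_diff: "(\<forall>l. \<alpha> l \<le> \<kappa> l) \<Longrightarrow> mdeg \<alpha> + mdeg (\<lambda>l. \<kappa> l - \<alpha> l) = mdeg \<kappa>"
  by (simp add: mdeg_add[symmetric])

lemma conv_series_cauchy_prod:
  assumes "conv_series a" "conv_series b"
  shows "conv_series (cauchy_prod a b)"
    and "\<forall>\<^sub>F z in nhds 0. pseries (cauchy_prod a b) z = pseries a z * pseries b z"
proof -
  obtain L where L: "L \<ge> 1" "\<And>\<kappa>. cmod (a \<kappa>) \<le> L * L ^ mdeg \<kappa>" by (rule conv_seriesE[OF assms(1)]) blast
  obtain M where M: "M \<ge> 1" "\<And>\<kappa>. cmod (b \<kappa>) \<le> M * M ^ mdeg \<kappa>" by (rule conv_seriesE[OF assms(2)]) blast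
  show "conv_series (cauchy_prod a b)"
  proof (rule conv_seriesI)
    fix \<kappa> :: "'a \<Rightarrow> nat"
    have "cmod (a \<alpha> * b (\<lambda>l. \<kappa> l - \<alpha> l)) \<le> L * M * (L * M) ^ mdeg \<kappa>" if "\<forall>l. \<alpha> l \<le> \<kappa> l" for \<alpha>
    proof -
      have "mdeg \<alpha> \<le> mdeg \<kappa>" "mdeg (\<lambda>l. \<kappa> l - \<alpha> l) \<le> mdeg \<kappa>" using mdeg_diff[OF that] by auto
      then have "L ^ mdeg \<alpha> \<le> L ^ mdeg \<kappa>" "M ^ mdeg (\<lambda>l. \<kappa> l - \<alpha> l) \<le> M ^ mdeg \<kappa>"
        using L(1) M(1) by (auto intro: power_increasing)
      then have "cmod (a \<alpha>) \<le> L * L ^ mdeg \<kappa>" "cmod (b (\<lambda>l. \<kappa> l - \<alpha> l)) \<le> M * M ^ mdeg \<kappa>"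
        using L M by (auto intro: order_trans[OF L(2)] order_trans[OF M(2)])
      then have "cmod (a \<alpha>) * cmod (b (\<lambda>l. \<kappa> l - \<alpha> l)) \<le> (L * L ^ mdeg \<kappa>) * (M * M ^ mdeg \<kappa>)"
        using L(1) by (intro mult_mono) auto
      then show ?thesis by (simp add: norm_mult power_mult_distrib mult_ac)
    qed
    then have "cmod (cauchy_prod a b \<kappa>) \<le> real (card {\<alpha>. \<forall>l. \<alpha> l \<le> \<kappa> l}) * (L * M * (L * M) ^ mdeg \<kappa>)"
      unfolding cauchy_prod_def by (intro order_trans[OF norm_sum] sum_bounded_above) auto
    also have "\<dots> \<le> 2 ^ mdeg \<kappa> * (L * M * (L * M) ^ mdeg \<kappa>)"
      using L(1) M(1) card_below[of \<kappa>] by (intro mult_right_mono) (auto simp flip: of_nat_le_iff)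
    finally show "cmod (cauchy_prod a b \<kappa>) \<le> (L * M) * (2 * (L * M)) ^ mdeg \<kappa>"
      by (simp add: power_mult_distrib mult_ac)
  qed
  show "\<forall>\<^sub>F z in nhds 0. pseries (cauchy_prod a b) z = pseries a z * pseries b z"
    using conv_series_abs_summable[OF assms(1)] conv_series_abs_summable[OF assms(2)]
      conv_series_has_sum[OF assms(1)] conv_series_has_sum[OF assms(2)]
  proof eventually_elim
    case (elim z)
    let ?f = "\<lambda>(\<alpha>, \<beta>). (a \<alpha> * mono_at z \<alpha>) * (b \<beta> * mono_at z \<beta>)"
    have "(\<lambda>x. norm (?f x)) summable_on (UNIV \<times> UNIV)"
    proof (rule summable_on_SigmaI)
      show "((\<lambda>\<beta>. norm (?f (\<alpha>, \<beta>))) has_sum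
          (norm (a \<alpha> * mono_at z \<alpha>) * (\<Sum>\<^sub>\<infinity>\<beta>. norm (b \<beta> * mono_at z \<beta>)))) UNIV" for \<alpha>
        using has_sum_cmult_right[OF has_sum_infsum[OF elim(2)]] by (simp add: norm_mult)
      show "(\<lambda>\<alpha>. norm (a \<alpha> * mono_at z \<alpha>) * (\<Sum>\<^sub>\<infinity>\<beta>. norm (b \<beta> * mono_at z \<beta>))) summable_on UNIV"
        by (rule summable_on_cmult_left[OF elim(1)])
    qed auto
    then have sm: "?f summable_on (UNIV \<times> UNIV)" by (rule abs_summable_summable)
    have hs: "(?f has_sum (pseries a z * pseries b z)) (UNIV \<times> UNIV)"
    proof (rule has_sum_SigmaI[OF _ _ sm])
      show "((\<lambda>\<beta>. ?f (\<alpha>, \<beta>)) has_sum ((a \<alpha> * mono_at z \<alpha>) * pseries b z)) UNIV" for \<alpha>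
        using has_sum_cmult_right[OF elim(4)] by simp
      show "((\<lambda>\<alpha>. (a \<alpha> * mono_at z \<alpha>) * pseries b z) has_sum (pseries a z * pseries b z)) UNIV"
        by (rule has_sum_cmult_left[OF elim(3)])
    qed
    \<comment> \<open>Regroup the double sum by the total exponent: a pair
      \<open>(\<kappa>, \<alpha>)\<close> with \<open>\<alpha>\<close> below \<open>\<kappa>\<close>
      corresponds to \<open>(\<alpha>, \<kappa> - \<alpha>)\<close>, and below
      \<open>\<kappa>\<close> the truncated subtraction is exact.\<close>
    let ?g = "\<lambda>(\<kappa>, \<alpha>). (a \<alpha> * b (\<lambda>l. \<kappa> l - \<alpha> l)) * mono_at z \<kappa>"
    have "(?g has_sum (pseries a z * pseries b z)) (Sigma UNIV (\<lambda>\<kappa>. {\<alpha>. \<forall>l. \<alpha> l \<le> \<kappa> l})) \<longleftrightarrow>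
      (?f has_sum (pseries a z * pseries b z)) (UNIV \<times> UNIV)"
    proof (rule has_sum_reindex_bij_witness[where i = "\<lambda>(\<alpha>, \<beta>). (\<lambda>l. \<alpha> l + \<beta> l, \<alpha>)" and j = "\<lambda>(\<kappa>, \<alpha>). (\<alpha>, \<lambda>l. \<kappa> l - \<alpha> l)"])
      fix x :: "('a \<Rightarrow> nat) \<times> ('a \<Rightarrow> nat)" assume "x \<in> Sigma UNIV (\<lambda>\<kappa>. {\<alpha>. \<forall>l. \<alpha> l \<le> \<kappa> l})"
      then obtain \<kappa> \<alpha> where x: "x = (\<kappa>, \<alpha>)" "\<forall>l. \<alpha> l \<le> \<kappa> l" by auto
      then have "mono_at z \<kappa> = mono_at z \<alpha> * mono_at z (\<lambda>l. \<kappa> l - \<alpha> l)"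
        by (simp flip: mono_at_add)
      then show "?f ((\<lambda>(\<kappa>, \<alpha>). (\<alpha>, \<lambda>l. \<kappa> l - \<alpha> l)) x) = ?g x" using x by simp
    qed auto
    then have "(?g has_sum (pseries a z * pseries b z)) (Sigma UNIV (\<lambda>\<kappa>. {\<alpha>. \<forall>l. \<alpha> l \<le> \<kappa> l}))"
      using hs by blast
    then have "((\<lambda>\<kappa>. cauchy_prod a b \<kappa> * mono_at z \<kappa>) has_sum (pseries a z * pseries b z)) UNIV"
      by (rule has_sum_SigmaD) (auto simp: cauchy_prod_def sum_distrib_right intro!: has_sum_finiteI)
    then show ?case by (simp add: pseries_def infsumI)
  qed
qed

subsection \<open>Derivatives of power series\<close>

definition pd :: "'n \<Rightarrow> (('n::finite \<Rightarrow> nat) \<Rightarrow> complex) \<Rightarrow> ('n \<Rightarrow> nat) \<Rightarrow> complex" where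
  "pd l c \<kappa> = of_nat (Suc (\<kappa> l)) * c (\<kappa>(l := Suc (\<kappa> l)))"

lemma mdeg_upd_Suc [simp]: "mdeg (\<kappa>(l := Suc (\<kappa> l))) = Suc (mdeg \<kappa>)"
  using mdeg_upd[of \<kappa> l "Suc (\<kappa> l)"] by simp

lemma conv_series_pd:
  assumes "conv_series c"
  shows "conv_series (pd l c)"
proof -
  obtain L where L: "L \<ge> 1" "\<And>\<kappa>. cmod (c \<kappa>) \<le> L * L ^ mdeg \<kappa>" by (rule conv_seriesE[OF assms]) blast
  show ?thesis
  proof (rule conv_seriesI)
    fix \<kappa>
    have "Suc (\<kappa> l) \<le> 2 ^ mdeg \<kappa>"
      using Suc_le_power2[of "mdeg \<kappa>"] le_mdeg[of \<kappa> l] by linarith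
    then have "real (Suc (\<kappa> l)) \<le> real (2 ^ mdeg \<kappa>)" by (simp only: of_nat_le_iff)
    then have "real (Suc (\<kappa> l)) \<le> 2 ^ mdeg \<kappa>" by simp
    then have "cmod (pd l c \<kappa>) \<le> 2 ^ mdeg \<kappa> * (L * L ^ Suc (mdeg \<kappa>))"
      unfolding pd_def norm_mult norm_of_nat using L(2)[of "\<kappa>(l := Suc (\<kappa> l))"]
      by (intro mult_mono) auto
    then show "cmod (pd l c \<kappa>) \<le> (L * L) * (2 * L) ^ mdeg \<kappa>" by (simp add: power_mult_distrib mult_ac)
  qed
qed

lemma mono_at_has_derivative:
  "((\<lambda>z. mono_at z \<kappa>) has_derivative
     (\<lambda>v. \<Sum>l\<in>UNIV. v $ l * (of_nat (\<kappa> l) * mono_at z (\<kappa>(l := \<kappa> l - 1))))) (at z within S)"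
proof -
  have nth: "((\<lambda>z. z $ l) has_derivative (\<lambda>v. v $ l)) (at z within S)" for l
    by (rule bounded_linear.has_derivative[OF bounded_linear_vec_nth has_derivative_ident])
  have "((\<lambda>z. \<Prod>l\<in>UNIV. z $ l ^ \<kappa> l) has_derivative
     (\<lambda>v. \<Sum>l\<in>UNIV. (of_nat (\<kappa> l) * v $ l * z $ l ^ (\<kappa> l - 1)) * (\<Prod>j\<in>UNIV - {l}. z $ j ^ \<kappa> j))) (at z within S)"
    by (rule has_derivative_prod) (rule has_derivative_power[OF nth])
  moreover have "mono_at z (\<kappa>(l := \<kappa> l - 1)) = z $ l ^ (\<kappa> l - 1) * (\<Prod>j\<in>UNIV - {l}. z $ j ^ \<kappa> j)" for l
    unfolding mono_at_def by (subst prod.remove[of _ l]) (auto intro!: prod.cong)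
  ultimately show ?thesis unfolding mono_at_def[of _ \<kappa>] by (simp add: mult_ac)
qed

text \<open>Termwise differentiation under a summable majorant. The differentiation theorem concerns
  sequences of functions, so the multi-indices are enumerated by a bijection \<open>e\<close> with
  the naturals.\<close>

lemma pseries_has_derivative:
  fixes c :: "('n::finite \<Rightarrow> nat) \<Rightarrow> complex"
  assumes "conv_series c"
  shows "\<forall>\<^sub>F z in nhds 0. (pseries c has_derivative (\<lambda>v. \<Sum>l\<in>UNIV. v $ l * pseries (pd l c) z)) (at z)"
proof -
  obtain L where L: "L \<ge> 1" "\<And>\<kappa>. cmod (c \<kappa>) \<le> L * L ^ mdeg \<kappa>" by (rule conv_seriesE[OF assms]) blast
  \<comment> \<open>With \<open>L * \<rho> = 1 / 4\<close> there is room for the factor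
    \<open>\<kappa> l\<close> of the differentiated terms, which is at most
    \<open>2 ^ mdeg \<kappa>\<close>: the majorant keeps the ratio 1/2.\<close>
  define \<rho> where "\<rho> = 1 / (4 * L)"
  have \<rho>: "\<rho> > 0" "L * \<rho> = 1 / 4" using L(1) by (auto simp: \<rho>_def)
  let ?S = "polydisc \<rho> :: (complex ^ 'n) set"
  have cvx: "convex ?S"
  proof (rule convexI)
    fix x y :: "complex ^ 'n" and u v :: real
    assume xy: "x \<in> ?S" "y \<in> ?S" "0 \<le> u" "0 \<le> v" "u + v = 1"
    have "u *\<^sub>R x $ l + v *\<^sub>R y $ l \<in> ball 0 \<rho>" for l
      using xy by (intro convexD[OF convex_ball]) (auto simp: polydisc_def)
    then show "u *\<^sub>R x + v *\<^sub>R y \<in> ?S" by (simp add: polydisc_def)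
  qed
  have opn: "open ?S" by (rule open_polydisc)
  define e :: "nat \<Rightarrow> 'n \<Rightarrow> nat" where "e = from_nat_into UNIV"
  have "inj (\<lambda>k::nat. (\<lambda>_::'n. k))" by (auto intro!: injI dest: fun_cong)
  then have "infinite (range (\<lambda>k::nat. (\<lambda>_::'n. k)))" by (simp add: finite_image_iff)
  then have "infinite (UNIV :: ('n \<Rightarrow> nat) set)" using finite_subset[OF subset_UNIV] by blast
  then have e: "bij_betw e UNIV UNIV" unfolding e_def by (intro bij_betw_from_nat_into) auto
  \<comment> \<open>The \<open>l\<close>-th partial derivative of the term of index
    \<open>\<kappa>\<close>. When \<open>\<kappa> l = 0\<close> the truncated exponent is harmless,
    the factor in front being 0.\<close>
  define T where "T = (\<lambda>l \<kappa> x. c \<kappa> * (of_nat (\<kappa> l) * mono_at x (\<kappa>(l := \<kappa> l - 1))))"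
  have T: "norm (T l \<kappa> x) \<le> (L / \<rho>) * (1/2) ^ mdeg \<kappa>" if "x \<in> ?S" for l \<kappa> x
  proof (cases "\<kappa> l")
    case 0
    then show ?thesis using \<rho> L(1) by (simp add: T_def)
  next
    case (Suc k)
    let ?\<kappa>' = "\<kappa>(l := k)"
    have md: "mdeg \<kappa> = Suc (mdeg ?\<kappa>')" using mdeg_upd_Suc[of ?\<kappa>' l] Suc fun_upd_triv[of \<kappa> l] by simp
    have "\<kappa> l \<le> 2 ^ mdeg \<kappa>" using Suc_le_power2[of "mdeg \<kappa>"] le_mdeg[of \<kappa> l] by linarith
    then have "real (\<kappa> l) \<le> 2 ^ mdeg \<kappa>" by (simp flip: of_nat_le_iff)
    moreover have "cmod (mono_at x ?\<kappa>') \<le> \<rho> ^ mdeg ?\<kappa>'"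
      by (rule norm_mono_at_le) (use that in \<open>auto simp: polydisc_def intro: less_imp_le\<close>)
    ultimately have "norm (T l \<kappa> x) \<le> (L * L ^ mdeg \<kappa>) * (2 ^ mdeg \<kappa> * \<rho> ^ mdeg ?\<kappa>')"
      unfolding T_def norm_mult norm_of_nat using L Suc by (intro mult_mono) auto
    also have "\<dots> = (L / \<rho>) * ((L * \<rho>) ^ mdeg \<kappa> * 2 ^ mdeg \<kappa>)"
      using \<rho>(1) by (simp add: md power_mult_distrib)
    also have "(L * \<rho>) ^ mdeg \<kappa> * 2 ^ mdeg \<kappa> = (1/2) ^ mdeg \<kappa>"
      unfolding \<rho>(2) by (simp flip: power_mult_distrib)
    finally show ?thesis .
  qed
  have smM: "(\<lambda>\<kappa>::'n \<Rightarrow> nat. (L / \<rho>) * (1/2) ^ mdeg \<kappa>) summable_on UNIV"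
    by (intro summable_on_cmult_right summable_on_power_mdeg) auto
  then have "(\<lambda>n. (L / \<rho>) * (1/2) ^ mdeg (e n)) summable_on UNIV"
    using summable_on_reindex_bij_betw[OF e, of "\<lambda>\<kappa>. (L / \<rho>) * (1/2) ^ mdeg \<kappa>"] by blast
  then have smN: "summable (\<lambda>n. (L / \<rho>) * (1/2) ^ mdeg (e n))"
    by (rule summable_on_imp_summable)
  have Tsum: "(\<lambda>n. T l (e n) x) sums pseries (pd l c) x" if x: "x \<in> ?S" for l x
  proof -
    have "(\<lambda>\<kappa>. T l \<kappa> x) summable_on UNIV"
      by (rule abs_summable_summable, rule Infinite_Sum.abs_summable_on_comparison_test'[OF smM]) (rule T[OF x])
    then have "((\<lambda>\<kappa>. T l \<kappa> x) has_sum (\<Sum>\<^sub>\<infinity>\<kappa>. T l \<kappa> x)) UNIV" by simp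
    moreover have "(\<Sum>\<^sub>\<infinity>\<kappa>. T l \<kappa> x) = (\<Sum>\<^sub>\<infinity>\<kappa>\<in>{\<kappa>. \<kappa> l \<noteq> 0}. T l \<kappa> x)"
      by (rule infsum_cong_neutral) (auto simp: T_def)
    moreover have "\<dots> = pseries (pd l c) x"
      unfolding pseries_def
      by (rule infsum_reindex_bij_witness[where i = "\<lambda>\<kappa>. \<kappa>(l := Suc (\<kappa> l))" and j = "\<lambda>\<kappa>. \<kappa>(l := \<kappa> l - 1)"])
        (auto simp: T_def pd_def)
    ultimately have "((\<lambda>\<kappa>. T l \<kappa> x) has_sum pseries (pd l c) x) UNIV" by simp
    then have "((\<lambda>n. T l (e n) x) has_sum pseries (pd l c) x) UNIV"
      using has_sum_reindex_bij_betw[OF e, of "\<lambda>\<kappa>. T l \<kappa> x"] by simp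
    then show ?thesis by (rule has_sum_imp_sums)
  qed
  have ulim: "uniform_limit ?S (\<lambda>n x. \<Sum>i<n. T l (e i) x) (\<lambda>x. pseries (pd l c) x) sequentially" for l
  proof -
    have "uniform_limit ?S (\<lambda>n x. \<Sum>i<n. T l (e i) x) (\<lambda>x. suminf (\<lambda>i. T l (e i) x)) sequentially"
      by (rule Weierstrass_m_test[OF T smN])
    then show ?thesis by (rule uniform_limit_cong'[THEN iffD1, rotated 2]) (use Tsum in \<open>auto simp: sums_iff\<close>)
  qed
  let ?f = "\<lambda>n x. c (e n) * mono_at x (e n)"
  let ?f' = "\<lambda>n x v. \<Sum>l\<in>UNIV. v $ l * T l (e n) x"
  let ?g' = "\<lambda>x v. \<Sum>l\<in>UNIV. v $ l * pseries (pd l c) x"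
  have fsum: "(\<lambda>n. ?f n x) sums pseries c x" if x: "x \<in> ?S" for x
  proof -
    have "(\<lambda>\<kappa>. c \<kappa> * mono_at x \<kappa>) abs_summable_on UNIV"
      by (rule abs_summable_on_power_series[OF L(2), where \<rho> = \<rho>])
        (use x L(1) \<rho> in \<open>auto simp: polydisc_def intro: less_imp_le\<close>)
    then have "((\<lambda>\<kappa>. c \<kappa> * mono_at x \<kappa>) has_sum pseries c x) UNIV"
      unfolding pseries_def by (rule has_sum_infsum[OF abs_summable_summable])
    then have "((\<lambda>n. ?f n x) has_sum pseries c x) UNIV"
      using has_sum_reindex_bij_betw[OF e, of "\<lambda>\<kappa>. c \<kappa> * mono_at x \<kappa>"] by simp
    then show ?thesis by (rule has_sum_imp_sums)
  qed
  have deriv: "(?f n has_derivative ?f' n x) (at x within ?S)" for n x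
  proof -
    have "(?f n has_derivative (\<lambda>v. c (e n) * (\<Sum>l\<in>UNIV. v $ l * (of_nat (e n l) * mono_at x ((e n)(l := e n l - 1)))))) (at x within ?S)"
      by (intro has_derivative_mult_right mono_at_has_derivative)
    then show ?thesis by (simp add: T_def sum_distrib_left mult_ac)
  qed
  have unif: "\<forall>\<^sub>F n in sequentially. \<forall>x\<in>?S. \<forall>v. norm ((\<Sum>i<n. ?f' i x v) - ?g' x v) \<le> \<epsilon> * norm v"
    if "\<epsilon> > 0" for \<epsilon>
  proof -
    let ?\<epsilon> = "\<epsilon> / CARD('n)"
    have "\<forall>\<^sub>F n in sequentially. \<forall>l. \<forall>x\<in>?S. dist (\<Sum>i<n. T l (e i) x) (pseries (pd l c) x) < ?\<epsilon>"
      using ulim that by (intro eventually_all_finite uniform_limitD) auto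
    then show ?thesis
    proof eventually_elim
      case (elim n)
      show ?case
      proof (intro ballI allI)
        fix x v assume x: "x \<in> ?S"
        have "(\<Sum>i<n. ?f' i x v) - ?g' x v = (\<Sum>l\<in>UNIV. v $ l * ((\<Sum>i<n. T l (e i) x) - pseries (pd l c) x))"
          by (subst sum.swap) (simp add: sum_subtractf sum_distrib_left right_diff_distrib)
        also have "norm \<dots> \<le> (\<Sum>l\<in>(UNIV :: 'n set). norm v * ?\<epsilon>)"
          using elim x
          by (intro sum_norm_le order_trans[OF norm_mult_ineq] mult_mono)
            (auto simp: dist_norm Finite_Cartesian_Product.norm_nth_le intro: less_imp_le)
        finally show "norm ((\<Sum>i<n. ?f' i x v) - ?g' x v) \<le> \<epsilon> * norm v" by (simp add: mult.commute)
      qed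
    qed
  qed
  have zero: "0 \<in> ?S" using \<rho> by (simp add: polydisc_def)
  obtain G where G: "\<And>x. x \<in> ?S \<Longrightarrow> (\<lambda>n. ?f n x) sums G x"
    "\<And>x. x \<in> ?S \<Longrightarrow> (G has_derivative ?g' x) (at x within ?S)"
    using has_derivative_series[OF cvx deriv unif zero fsum[OF zero]] by blast
  have "(pseries c has_derivative ?g' x) (at x)" if x: "x \<in> ?S" for x
  proof -
    have "(pseries c has_derivative ?g' x) (at x within ?S)"
      using G(2)[OF x] by (rule has_derivative_transform[OF x, rotated]) (use G(1) fsum sums_unique2 in blast)
    then show ?thesis using at_within_open[OF x opn] by simp
  qed
  then show ?thesis
    unfolding eventually_nhds_0_polydisc using \<rho>(1) by (intro exI[of _ \<rho>]) (auto simp: polydisc_def)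
qed

lemma pseries_at_0: "pseries c 0 = c (\<lambda>_. 0)"
proof -
  have "pseries c 0 = (\<Sum>\<^sub>\<infinity>\<kappa>\<in>{\<lambda>_. 0}. c \<kappa> * mono_at 0 \<kappa>)"
    unfolding pseries_def by (rule infsum_cong_neutral) (auto simp: mono_at_def fun_eq_iff)
  then show ?thesis by simp
qed

text \<open>A coefficient of degree \<open>k + 1\<close> is, up to a nonzero integer factor, a
  coefficient of degree \<open>k\<close> of some \<open>pd l c\<close>, and differentiation
  preserves vanishing near 0.\<close>

lemma pseries_eq_0:
  fixes c :: "('n::finite \<Rightarrow> nat) \<Rightarrow> complex"
  shows "conv_series c \<Longrightarrow> \<forall>\<^sub>F z in nhds 0. pseries c z = 0 \<Longrightarrow> c \<kappa> = 0"
proof (induction "mdeg \<kappa>" arbitrary: c \<kappa>)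
  case 0
  then show ?case using pseries_at_0[of c] eventually_nhds_x_imp_x[OF 0(3)] by (simp add: mdeg_eq_0_iff)
next
  case (Suc k)
  have "mdeg \<kappa> \<noteq> 0" using Suc.hyps(2) by simp
  then obtain l where l: "\<kappa> l > 0" by (auto simp: mdeg_eq_0_iff)
  let ?\<kappa>' = "\<kappa>(l := \<kappa> l - 1)"
  have k: "k = mdeg ?\<kappa>'" using mdeg_upd[of \<kappa> l "\<kappa> l - 1"] Suc.hyps(2) l by simp
  \<comment> \<open>Differentiating at \<open>z\<close> takes vanishing on a neighbourhood of
    \<open>z\<close>; this holds for all \<open>z\<close> near 0.\<close>
  have nested: "\<forall>\<^sub>F z in nhds 0. \<forall>\<^sub>F w in nhds z. pseries c w = 0"
    unfolding eventually_eventually by (rule Suc.prems(2))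
  have "\<forall>\<^sub>F z in nhds 0. pseries (pd l c) z = 0"
    using pseries_has_derivative[OF Suc.prems(1)] nested
  proof eventually_elim
    case (elim z)
    have "((\<lambda>_. 0) has_derivative (\<lambda>v. \<Sum>l\<in>UNIV. v $ l * pseries (pd l c) z)) (at z)"
    proof (rule has_derivative_transform_eventually[OF elim(1)])
      show "\<forall>\<^sub>F w in at z. pseries c w = 0"
        unfolding eventually_at_filter using elim(2) by (rule eventually_mono) simp
      show "pseries c z = 0" by (rule eventually_nhds_x_imp_x[OF elim(2)])
    qed simp
    then have "(\<lambda>v. \<Sum>l\<in>UNIV. v $ l * pseries (pd l c) z) = (\<lambda>_. 0)"
      using has_derivative_unique[OF _ has_derivative_const] by blast
    from fun_cong[OF this, of "axis l 1"] show ?case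
      by (simp add: axis_def if_distrib[of "\<lambda>x. x * _"] cong: if_cong)
  qed
  then have "pd l c ?\<kappa>' = 0"
    by (intro Suc.hyps(1)[OF k] conv_series_pd[OF Suc.prems(1)])
  moreover have "Suc (\<kappa> l - 1) = \<kappa> l" using l by simp
  ultimately show ?case using l by (simp add: pd_def del: of_nat_Suc)
qed

lemma pseries_unique:
  assumes "conv_series a" "conv_series b" "\<forall>\<^sub>F z in nhds 0. pseries a z = pseries b z"
  shows "a = b"
proof
  fix \<kappa>
  note b' = conv_series_cmult[OF assms(2), of "-1"]
  have "\<forall>\<^sub>F z in nhds 0. pseries (\<lambda>\<kappa>. a \<kappa> + (-1) * b \<kappa>) z = 0"
    using conv_series_add(2)[OF assms(1) b'(1)] assms(3) by eventually_elim (simp only: b'(2), simp)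
  from pseries_eq_0[OF conv_series_add(1)[OF assms(1) b'(1)] this, of \<kappa>] show "a \<kappa> = b \<kappa>" by simp
qed

section \<open>Sets of positive capacity\<close>

lemma log_ereal_measurable [measurable]: "log_ereal \<in> borel_measurable borel"
proof -
  have eq: "log_ereal = (\<lambda>x. if x = 0 then -\<infinity> else ereal (ln x))" by (auto simp: log_ereal_def)
  show ?thesis unfolding eq by measurable
qed

text \<open>The integrand of the subtracted term of \<open>log_energy\<close>: max(0, -log x),
  infinite at 0. Being unsigned, it gives potentials that are defined for every measure and decrease
  under restriction to a subset.\<close>

definition neg_log :: "real \<Rightarrow> ennreal" where
  "neg_log x = e2ennreal (- log_ereal x)"

lemma neg_log_measurable [measurable]: "neg_log \<in> borel_measurable borel"
  unfolding neg_log_def[abs_def] by measurable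

lemma neg_log_pos: "x > 0 \<Longrightarrow> neg_log x = ennreal (- ln x)"
  by (simp add: neg_log_def log_ereal_def e2ennreal_ereal)

lemma neg_log_0 [simp]: "neg_log 0 = \<infinity>"
  by (simp add: neg_log_def log_ereal_def)

lemma neg_log_antimono: "0 \<le> x \<Longrightarrow> x \<le> y \<Longrightarrow> neg_log y \<le> neg_log x"
  by (cases "x = 0") (auto simp: neg_log_pos intro!: ennreal_leI)

text \<open>Truncation at 0 turns the additivity of the logarithm into subadditivity.\<close>

lemma neg_log_mult: "0 \<le> x \<Longrightarrow> 0 \<le> y \<Longrightarrow> neg_log (x * y) \<le> neg_log x + neg_log y"
proof (cases "x = 0 \<or> y = 0")
  case False
  assume "0 \<le> x" "0 \<le> y"
  with False have xy: "x > 0" "y > 0" by auto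
  then have "neg_log (x * y) = ennreal (- ln x + - ln y)"
    by (simp add: neg_log_pos ln_mult)
  also have "\<dots> \<le> ennreal (max 0 (- ln x) + max 0 (- ln y))" by (intro ennreal_leI) auto
  also have "\<dots> = ennreal (max 0 (- ln x)) + ennreal (max 0 (- ln y))" by (rule ennreal_plus) auto
  also have "\<dots> = neg_log x + neg_log y"
    using xy by (simp add: neg_log_pos max_def ennreal_neg)
  finally show ?thesis .
qed auto

lemma exp_le_of_neg_log_le:
  assumes "0 \<le> x" "neg_log x \<le> ennreal r" "0 \<le> r"
  shows "exp (- r) \<le> x"
proof -
  have "x \<noteq> 0" using assms(2) by (auto simp: top_unique)
  with assms have "x > 0" "- r \<le> ln x" by (auto simp: neg_log_pos ennreal_le_iff)
  then show ?thesis by (simp add: ln_ge_iff)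
qed

text \<open>The complement of the support is the union of the open null sets, which by second
  countability is the union of countably many of them.\<close>

lemma measure_support_AE:
  fixes \<mu> :: "'a :: second_countable_topology measure"
  assumes [simp]: "sets \<mu> = sets borel"
  shows "AE x in \<mu>. x \<in> measure_support \<mu>"
proof -
  define F where "F = {U. open U \<and> emeasure \<mu> U = 0}"
  obtain F' where F': "F' \<subseteq> F" "countable F'" "\<Union>F' = \<Union>F"
    by (rule Lindelof[of F]) (auto simp: F_def)
  have "(\<Union>U\<in>F'. U) \<in> null_sets \<mu>"
    using F' by (intro null_sets_UN') (auto simp: F_def null_sets_def)
  then have "\<Union>F \<in> null_sets \<mu>" using F'(3) by simp
  then have "AE x in \<mu>. x \<notin> \<Union>F" by (rule AE_not_in)
  then show ?thesis
    by eventually_elim (auto simp: F_def measure_support_def zero_less_iff_neq_zero)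
qed

text \<open>Distances within the bounded support are bounded. As the first term of
  \<open>log_energy\<close> is finite, an infinite second term makes the energy
  \<open>-\<infinity>\<close>, whose exponential is 0.\<close>

lemma finite_upper_energy:
  fixes \<mu> :: "complex measure"
  assumes "\<mu> \<in> compact_prob_measures E"
  shows "(\<integral>\<^sup>+z. (\<integral>\<^sup>+w. e2ennreal (log_ereal (cmod (z - w))) \<partial>\<mu>) \<partial>\<mu>) < \<infinity>"
proof -
  have mu: "sets \<mu> = sets borel" "prob_space \<mu>" "compact (measure_support \<mu>)"
    using assms by (auto simp: compact_prob_measures_def)
  interpret prob_space \<mu> by (rule mu)
  obtain R where R: "\<And>x. x \<in> measure_support \<mu> \<Longrightarrow> cmod x \<le> R"
    using compact_imp_bounded[OF mu(3)] by (auto simp: bounded_iff)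
  have le: "e2ennreal (log_ereal (cmod (z - w))) \<le> ennreal (2 * R)"
    if "z \<in> measure_support \<mu>" "w \<in> measure_support \<mu>" for z w
  proof (cases "z = w")
    case False
    have "cmod (z - w) \<le> 2 * R" using norm_triangle_ineq4[of z w] R[OF that(1)] R[OF that(2)] by linarith
    then have "ln (cmod (z - w)) \<le> 2 * R" using ln_le_minus_one[of "cmod (z - w)"] False by auto
    then show ?thesis using False by (simp add: log_ereal_def e2ennreal_ereal ennreal_leI)
  qed (simp add: log_ereal_def e2ennreal_neg)
  have "AE z in \<mu>. (\<integral>\<^sup>+w. e2ennreal (log_ereal (cmod (z - w))) \<partial>\<mu>) \<le> ennreal (2 * R)"
    using measure_support_AE[OF mu(1)]
  proof eventually_elim
    case (elim z)
    have "AE w in \<mu>. e2ennreal (log_ereal (cmod (z - w))) \<le> ennreal (2 * R)"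
      using measure_support_AE[OF mu(1)] by eventually_elim (rule le[OF elim])
    then have "(\<integral>\<^sup>+w. e2ennreal (log_ereal (cmod (z - w))) \<partial>\<mu>) \<le> (\<integral>\<^sup>+w. ennreal (2 * R) \<partial>\<mu>)"
      by (rule nn_integral_mono_AE)
    then show ?case by (simp add: emeasure_space_1)
  qed
  then have "(\<integral>\<^sup>+z. (\<integral>\<^sup>+w. e2ennreal (log_ereal (cmod (z - w))) \<partial>\<mu>) \<partial>\<mu>) \<le> (\<integral>\<^sup>+z. ennreal (2 * R) \<partial>\<mu>)"
    by (rule nn_integral_mono_AE)
  also have "\<dots> < \<infinity>" by (simp add: emeasure_space_1)
  finally show ?thesis .
qed

text \<open>The potential of a measure of finite energy is finite almost everywhere, so it is bounded on a
  compact set of positive measure.\<close>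

lemma positive_capacity_bounded_potential:
  assumes E: "log_capacity E > 0" and F: "E \<subseteq> (\<Union>n::nat. F n)" "\<And>n. closed (F n)" "mono F"
  obtains K n \<mu> where "compact K" "K \<subseteq> F n" "finite_measure \<mu>" "sets \<mu> = sets borel" "emeasure \<mu> K > 0"
    "\<And>z. z \<in> K \<Longrightarrow> (\<integral>\<^sup>+w\<in>K. neg_log (cmod (z - w)) \<partial>\<mu>) \<le> of_nat n"
proof -
  obtain \<mu> where \<mu>: "\<mu> \<in> compact_prob_measures E" "exp_ereal (log_energy \<mu>) > 0"
    using E unfolding log_capacity_def less_SUP_iff by blast
  have mu: "sets \<mu> = sets borel" "prob_space \<mu>" "measure_support \<mu> \<subseteq> E"
    using \<mu>(1) by (auto simp: compact_prob_measures_def)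
  note [measurable_cong] = mu(1)
  interpret prob_space \<mu> by (rule mu)
  define u where "u z = (\<integral>\<^sup>+w. neg_log (cmod (z - w)) \<partial>\<mu>)" for z
  have u [measurable]: "u \<in> borel_measurable \<mu>" unfolding u_def by measurable
  have "(\<integral>\<^sup>+z. u z \<partial>\<mu>) \<noteq> \<infinity>"
  proof
    assume "(\<integral>\<^sup>+z. u z \<partial>\<mu>) = \<infinity>"
    then have "(\<integral>\<^sup>+z. (\<integral>\<^sup>+w. e2ennreal (- log_ereal (cmod (z - w))) \<partial>\<mu>) \<partial>\<mu>) = \<infinity>"
      by (simp add: u_def neg_log_def)
    moreover have "enn2ereal (\<integral>\<^sup>+z. (\<integral>\<^sup>+w. e2ennreal (log_ereal (cmod (z - w))) \<partial>\<mu>) \<partial>\<mu>) \<noteq> \<infinity>"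
      using finite_upper_energy[OF \<mu>(1)] by (auto simp: less_top[symmetric])
    ultimately have "log_energy \<mu> = -\<infinity>"
      unfolding log_energy_def by (simp add: minus_ereal_def)
    then show False using \<mu>(2) by (simp add: exp_ereal_def)
  qed
  then have fin: "AE z in \<mu>. u z \<noteq> \<infinity>" by (intro nn_integral_PInf_AE) auto
  \<comment> \<open>One index \<open>n\<close> governs both the exhaustion by \<open>F n\<close> and
    the bound on the potential. As \<open>F\<close> is increasing, the larger of two indices serves
    both purposes.\<close>
  define A where "A n = {z \<in> F n. u z \<le> of_nat n}" for n
  have A [measurable]: "A n \<in> sets \<mu>" for n
  proof -
    have "A n = F n \<inter> {z \<in> space \<mu>. u z \<le> of_nat n}"
      using sets_eq_imp_space_eq[OF mu(1)] by (auto simp: A_def)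
    moreover have "F n \<in> sets \<mu>" using F(2)[of n] by (simp add: mu(1))
    moreover have "{z \<in> space \<mu>. u z \<le> of_nat n} \<in> sets \<mu>" by measurable
    ultimately show ?thesis by simp
  qed
  have "\<exists>n. emeasure \<mu> (A n) > 0"
  proof (rule ccontr)
    assume "\<not> ?thesis"
    then have "A n \<in> null_sets \<mu>" for n using A by (auto simp: null_sets_def)
    then have "(\<Union>n. A n) \<in> null_sets \<mu>" by blast
    then have "AE z in \<mu>. z \<notin> (\<Union>n. A n)" by (rule AE_not_in)
    with fin measure_support_AE[OF mu(1)] have "AE z in \<mu>. False"
    proof eventually_elim
      case (elim z)
      then obtain m where m: "z \<in> F m" using mu(3) F(1) by blast
      from elim(1) obtain r where r: "u z = ennreal r" "r \<ge> 0" by (cases "u z") auto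
      define n where "n = max m (nat \<lceil>r\<rceil>)"
      have "r \<le> real n" by (simp add: n_def) linarith
      then have "u z \<le> of_nat n" using r by (simp add: ennreal_of_nat_eq_real_of_nat ennreal_leI)
      moreover have "z \<in> F n" using m monoD[OF F(3), of m n] by (auto simp: n_def)
      ultimately show ?case using elim(3) by (auto simp: A_def)
    qed
    then show False by simp
  qed
  then obtain n where n: "emeasure \<mu> (A n) > 0" by blast
  have "emeasure \<mu> (A n) = (SUP K \<in> {K. K \<subseteq> A n \<and> compact K}. emeasure \<mu> K)"
    using A[of n] by (intro inner_regular) (auto simp: mu(1))
  with n obtain K where K: "K \<subseteq> A n" "compact K" "emeasure \<mu> K > 0"
    by (auto simp: less_SUP_iff)
  show ?thesis
  proof (rule that[of K n \<mu>])
    fix z assume "z \<in> K"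
    then have "u z \<le> of_nat n" using K(1) by (auto simp: A_def)
    moreover have "(\<integral>\<^sup>+w\<in>K. neg_log (cmod (z - w)) \<partial>\<mu>) \<le> u z"
      unfolding u_def by (intro nn_integral_mono) (auto simp: indicator_def)
    ultimately show "(\<integral>\<^sup>+w\<in>K. neg_log (cmod (z - w)) \<partial>\<mu>) \<le> of_nat n" by simp
  qed (use K mu in \<open>auto simp: A_def finite_measure_axioms\<close>)
qed

section \<open>The Bernstein--Walsh inequality\<close>

text \<open>A bound for the potential on \<open>K\<close> extends to the plane by comparing \<open>z\<close> with the point of \<open>K\<close>
  nearest to it. Averaging over \<open>K\<close> then bounds a monic polynomial from below at some point of \<open>K\<close>.\<close>

lemma nearest_point_comparison:
  fixes K :: "complex set"
  assumes K: "compact K" "K \<noteq> {}" and R: "R \<ge> 0" "\<And>w. w \<in> K \<Longrightarrow> cmod w \<le> R"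
  obtains z' where "z' \<in> K" "\<And>w. w \<in> K \<Longrightarrow> 1 / (4 * R + 4) * cmod (z' - w) \<le> cmod (w - z) / (1 + cmod z)"
proof -
  obtain z' where z': "z' \<in> K" "\<And>w. w \<in> K \<Longrightarrow> dist z z' \<le> dist z w"
    using distance_attains_inf[OF compact_imp_closed[OF K(1)] K(2)] by blast
  have pos: "0 < 1 + cmod z" by (rule add_pos_nonneg) auto
  have "1 / (4 * R + 4) * cmod (z' - w) \<le> cmod (w - z) / (1 + cmod z)" if w: "w \<in> K" for w
  \<comment> \<open>Up to the threshold, \<open>1 + cmod z\<close> is at most
    \<open>2 * R + 2\<close> and minimality of \<open>z'\<close> gives
    \<open>cmod (z' - w) \<le> 2 * cmod (w - z)\<close>. Beyond it, \<open>cmod z - R\<close>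
    exceeds \<open>(1 + cmod z) / 2\<close>, while \<open>z'\<close> and \<open>w\<close> are at
    distance at most \<open>2 * R\<close>. Both cases yield the constant
    \<open>1 / (4 * R + 4)\<close>.\<close>
  proof (cases "cmod z \<le> 2 * R + 1")
    case True
    have "cmod (z' - w) \<le> dist z z' + dist z w"
      using dist_triangle[of z' w z] by (simp add: dist_norm norm_minus_commute)
    also have "\<dots> \<le> 2 * dist z w" using z'(2)[OF w] by simp
    finally have "1 / (4 * R + 4) * cmod (z' - w) \<le> 1 / (4 * R + 4) * (2 * cmod (w - z))"
      using R(1) by (intro mult_left_mono) (auto simp: dist_norm norm_minus_commute)
    also have "\<dots> = cmod (w - z) / (2 * R + 2)" using R(1) by (simp add: field_simps)
    also have "\<dots> \<le> cmod (w - z) / (1 + cmod z)"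
      using True R(1) pos by (intro divide_left_mono mult_pos_pos) auto
    finally show ?thesis .
  next
    case False
    have "cmod z - R \<le> cmod (w - z)" using norm_triangle_ineq2[of z w] R(2)[OF w] by (simp add: norm_minus_commute)
    then have "(1 + cmod z) / 2 \<le> cmod (w - z)" using False by argo
    then have "1 / 2 \<le> cmod (w - z) / (1 + cmod z)"
      by (simp add: field_simps add_pos_nonneg)
    moreover have "cmod (z' - w) \<le> 2 * R" using norm_triangle_ineq4[of z' w] R(2)[OF w] R(2)[OF z'(1)] by simp
    then have "1 / (4 * R + 4) * cmod (z' - w) \<le> 1 / (4 * R + 4) * (2 * R + 2)"
      using R(1) by (intro mult_left_mono) auto
    moreover have "1 / (4 * R + 4) * (2 * R + 2) = 1 / 2" using R(1) by (simp add: field_simps)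
    ultimately show ?thesis by linarith
  qed
  then show ?thesis using z'(1) that by blast
qed

text \<open>Dividing by \<open>1 + cmod z\<close> keeps the contribution of remote zeros bounded, so
  \<open>c\<close> depends neither on the number nor on the position of the points in
  \<open>zs\<close>.\<close>

lemma exists_point_large_product:
  fixes K :: "complex set"
  assumes K: "compact K" and \<mu>: "finite_measure \<mu>" "sets \<mu> = sets borel" "emeasure \<mu> K > 0"
    and pot: "\<And>z. z \<in> K \<Longrightarrow> (\<integral>\<^sup>+w\<in>K. neg_log (cmod (z - w)) \<partial>\<mu>) \<le> of_nat N"
  obtains c where "c > 0" "c \<le> 1"
    "\<forall>zs. \<exists>w\<in>K. c ^ length zs * (\<Prod>z\<leftarrow>zs. 1 + cmod z) \<le> (\<Prod>z\<leftarrow>zs. cmod (w - z))"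
proof -
  interpret finite_measure \<mu> by (rule \<mu>)
  note [measurable_cong] = \<mu>(2)
  have Ks [measurable]: "K \<in> sets \<mu>" using compact_imp_closed[OF K] by (simp add: \<mu>(2))
  have Kne: "K \<noteq> {}" using \<mu>(3) by auto
  obtain R where R: "R \<ge> 0" "\<And>w. w \<in> K \<Longrightarrow> cmod w \<le> R"
    using compact_imp_bounded[OF K] unfolding bounded_pos by (meson less_imp_le)
  define \<kappa> where "\<kappa> = 1 / (4 * R + 4)"
  have \<kappa>: "\<kappa> > 0" using R(1) by (simp add: \<kappa>_def)
  define \<phi> where "\<phi> z w = neg_log (cmod (w - z) / (1 + cmod z))" for z w
  have \<phi> [measurable]: "\<phi> z \<in> borel_measurable \<mu>" for z unfolding \<phi>_def by measurable
  define m where "m = measure \<mu> K"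
  have m: "emeasure \<mu> K = ennreal m" "m > 0"
    using \<mu>(3) by (simp_all add: m_def emeasure_eq_measure)
  \<comment> \<open>A bound for the integral of \<open>\<phi> z\<close> over \<open>K\<close> that
    is uniform in \<open>z\<close>: the constant of the nearest-point comparison, integrated over
    \<open>K\<close>, plus the bound \<open>N\<close> at the nearest point.\<close>
  define t where "t = max 0 (- ln \<kappa>) * m + real N"
  have t: "t \<ge> 0" using m(2) by (simp add: t_def)
  have bd: "(\<integral>\<^sup>+w\<in>K. \<phi> z w \<partial>\<mu>) \<le> ennreal t" for z
  proof -
    obtain z' where z': "z' \<in> K" "\<And>w. w \<in> K \<Longrightarrow> \<kappa> * cmod (z' - w) \<le> cmod (w - z) / (1 + cmod z)"
      unfolding \<kappa>_def by (rule nearest_point_comparison[OF K Kne R]) blast+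
    have "\<phi> z w \<le> neg_log \<kappa> + neg_log (cmod (z' - w))" if "w \<in> K" for w
      unfolding \<phi>_def using \<kappa> z'(2)[OF that]
      by (intro order_trans[OF neg_log_antimono neg_log_mult]) auto
    then have "(\<integral>\<^sup>+w\<in>K. \<phi> z w \<partial>\<mu>) \<le> (\<integral>\<^sup>+w. neg_log \<kappa> * indicator K w + neg_log (cmod (z' - w)) * indicator K w \<partial>\<mu>)"
      by (intro nn_integral_mono) (auto simp: indicator_def)
    also have "\<dots> = neg_log \<kappa> * emeasure \<mu> K + (\<integral>\<^sup>+w\<in>K. neg_log (cmod (z' - w)) \<partial>\<mu>)"
      by (simp add: nn_integral_add nn_integral_cmult_indicator)
    also have "\<dots> \<le> neg_log \<kappa> * emeasure \<mu> K + of_nat N" by (intro add_left_mono pot z'(1))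
    also have "neg_log \<kappa> = ennreal (max 0 (- ln \<kappa>))" using \<kappa> by (simp add: neg_log_pos max_def ennreal_neg)
    also have "ennreal (max 0 (- ln \<kappa>)) * emeasure \<mu> K + of_nat N = ennreal t"
      unfolding m(1) t_def using m(2) by (simp add: ennreal_mult ennreal_plus ennreal_of_nat_eq_real_of_nat)
    finally show ?thesis .
  qed
  define G where "G zs w = (\<Sum>z\<leftarrow>zs. \<phi> z w)" for zs w
  have G_meas [measurable]: "G zs \<in> borel_measurable \<mu>" for zs
    by (induction zs) (simp_all add: G_def[abs_def])
  have G_int: "(\<integral>\<^sup>+w\<in>K. G zs w \<partial>\<mu>) \<le> ennreal (real (length zs) * t)" for zs
  proof (induction zs)
    case Nil
    then show ?case by (simp add: G_def)
  next
    case (Cons z zs)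
    have "(\<integral>\<^sup>+w\<in>K. G (z # zs) w \<partial>\<mu>) = (\<integral>\<^sup>+w. \<phi> z w * indicator K w + G zs w * indicator K w \<partial>\<mu>)"
      by (simp add: G_def distrib_right)
    also have "\<dots> = (\<integral>\<^sup>+w\<in>K. \<phi> z w \<partial>\<mu>) + (\<integral>\<^sup>+w\<in>K. G zs w \<partial>\<mu>)"
      by (simp add: nn_integral_add)
    also have "\<dots> \<le> ennreal t + ennreal (real (length zs) * t)" by (intro add_mono bd Cons.IH)
    also have "\<dots> = ennreal (real (length (z # zs)) * t)" using t by (simp add: ennreal_plus[symmetric] distrib_right del: ennreal_plus)
    finally show ?case .
  qed
  have G_prod: "neg_log (\<Prod>z\<leftarrow>zs. cmod (w - z) / (1 + cmod z)) \<le> G zs w" for zs w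
  proof (induction zs)
    case Nil
    then show ?case by (simp add: G_def neg_log_pos)
  next
    case (Cons z zs)
    have nn: "0 \<le> (\<Prod>z\<leftarrow>zs. cmod (w - z) / (1 + cmod z))"
      by (intro prod_list_nonneg) auto
    have "neg_log (\<Prod>z\<leftarrow>z # zs. cmod (w - z) / (1 + cmod z)) \<le>
        neg_log (cmod (w - z) / (1 + cmod z)) + neg_log (\<Prod>z\<leftarrow>zs. cmod (w - z) / (1 + cmod z))"
      using neg_log_mult[OF _ nn, of "cmod (w - z) / (1 + cmod z)"] by simp
    also have "\<dots> \<le> G (z # zs) w" using Cons.IH by (simp add: G_def \<phi>_def add_left_mono)
    finally show ?case .
  qed
  \<comment> \<open>The mean of \<open>G zs\<close> over \<open>K\<close> is at most
    \<open>length zs * t / m\<close>. Using \<open>t + 1\<close> in place of \<open>t\<close> gives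
    a strict excess when \<open>zs\<close> is nonempty, so \<open>G zs\<close> cannot lie above
    \<open>length zs * ((t + 1) / m)\<close> on all of \<open>K\<close>.\<close>
  define c where "c = exp (- ((t + 1) / m))"
  have point: "\<exists>w\<in>K. c ^ length zs * (\<Prod>z\<leftarrow>zs. 1 + cmod z) \<le> (\<Prod>z\<leftarrow>zs. cmod (w - z))" for zs
  proof (cases "zs = []")
    case True
    then show ?thesis using Kne by auto
  next
    case False
    define q where "q = real (length zs) * ((t + 1) / m)"
    have q: "q \<ge> 0" using t m(2) by (simp add: q_def)
    have "\<exists>w\<in>K. G zs w \<le> ennreal q"
    proof (rule ccontr)
      assume "\<not> ?thesis"
      then have "(\<integral>\<^sup>+w\<in>K. ennreal q \<partial>\<mu>) \<le> (\<integral>\<^sup>+w\<in>K. G zs w \<partial>\<mu>)"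
        by (intro nn_integral_mono) (auto simp: indicator_def not_le intro: less_imp_le)
      also have "\<dots> \<le> ennreal (real (length zs) * t)" by (rule G_int)
      finally have "ennreal (q * m) \<le> ennreal (real (length zs) * t)"
        using q m by (simp add: nn_integral_cmult_indicator ennreal_mult)
      then have "q * m \<le> real (length zs) * t" using t by (simp add: ennreal_le_iff)
      then show False using m(2) False by (simp add: q_def distrib_left)
    qed
    then obtain w where w: "w \<in> K" "G zs w \<le> ennreal q" by blast
    have "exp (- q) \<le> (\<Prod>z\<leftarrow>zs. cmod (w - z) / (1 + cmod z))"
      using q order_trans[OF G_prod w(2)] by (intro exp_le_of_neg_log_le) (auto intro!: prod_list_nonneg)
    also have "\<dots> = (\<Prod>z\<leftarrow>zs. cmod (w - z)) / (\<Prod>z\<leftarrow>zs. 1 + cmod z)"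
      by (induction zs) auto
    also have "exp (- q) = c ^ length zs"
      by (simp add: c_def q_def exp_of_nat_mult[symmetric])
    finally have "c ^ length zs \<le> (\<Prod>z\<leftarrow>zs. cmod (w - z)) / (\<Prod>z\<leftarrow>zs. 1 + cmod z)" .
    moreover have "(\<Prod>z\<leftarrow>zs. 1 + cmod z) > 0" by (induction zs) (auto intro!: mult_pos_pos add_pos_nonneg)
    ultimately show ?thesis using w(1) by (auto simp: pos_le_divide_eq)
  qed
  show ?thesis by (rule that[of c, OF _ _ allI[OF point]]) (use t m(2) in \<open>auto simp: c_def\<close>)
qed

text \<open>With \<open>p\<close> factored over its zeros, the product of the numbers
  \<open>1 + cmod x\<close> bounds the growth at \<open>z\<close> from above and, up to
  \<open>c ^ length zs\<close>, the size at some \<open>w\<close> in \<open>K\<close> from below. It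
  cancels, and the zeros disappear from the estimate.\<close>

lemma bernstein_walsh_of_large_product:
  fixes p :: "complex poly"
  assumes c: "c > 0" "c \<le> 1" "\<forall>zs. \<exists>w\<in>K. c ^ length zs * (\<Prod>z\<leftarrow>zs. 1 + cmod z) \<le> (\<Prod>z\<leftarrow>zs. cmod (w - z))"
    and p: "degree p \<le> D" "\<And>w. w \<in> K \<Longrightarrow> cmod (poly p w) \<le> M"
  shows "cmod (poly p z) \<le> M * ((1 + cmod z) / c) ^ D"
proof -
  obtain w0 where "w0 \<in> K" using c(3)[rule_format, of "[]"] by auto
  then have M: "M \<ge> 0" using p(2)[of w0] norm_ge_zero order_trans by blast
  obtain zs where zs: "mset zs = proots p" using ex_mset by blast
  have "size (proots p) = degree p" by (rule size_proots_complex)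
  then have len: "length zs = degree p" by (metis zs size_mset)
  have "p = Polynomial.smult (lead_coeff p) (\<Prod>x\<leftarrow>zs. [:-x, 1:])"
    using complex_poly_decompose_multiset[of p] unfolding zs[symmetric] by (metis mset_map prod_mset_prod_list)
  moreover have "poly (\<Prod>x\<leftarrow>xs. [:-x, 1:]) w = (\<Prod>x\<leftarrow>xs. w - x)" for xs and w :: complex
    by (induction xs) (auto simp: algebra_simps)
  ultimately have "poly p w = lead_coeff p * (\<Prod>x\<leftarrow>zs. w - x)" for w
    by (metis poly_smult)
  moreover have "cmod (\<Prod>x\<leftarrow>xs. w - x) = (\<Prod>x\<leftarrow>xs. cmod (w - x))" for xs w
    by (induction xs) (auto simp: norm_mult)
  ultimately have norm: "cmod (poly p w) = cmod (lead_coeff p) * (\<Prod>x\<leftarrow>zs. cmod (w - x))" for w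
    by (simp add: norm_mult)
  have "(\<Prod>x\<leftarrow>xs. cmod (z - x)) \<le> (1 + cmod z) ^ length xs * (\<Prod>x\<leftarrow>xs. 1 + cmod x)" for xs
  proof (induction xs)
    case (Cons x xs)
    have "cmod (z - x) \<le> cmod z + cmod x" by (rule norm_triangle_ineq4)
    also have "\<dots> \<le> (1 + cmod z) * (1 + cmod x)" by (simp add: algebra_simps)
    finally have "cmod (z - x) * (\<Prod>x\<leftarrow>xs. cmod (z - x)) \<le>
        ((1 + cmod z) * (1 + cmod x)) * ((1 + cmod z) ^ length xs * (\<Prod>x\<leftarrow>xs. 1 + cmod x))"
      using Cons.IH by (intro mult_mono) (auto intro!: prod_list_nonneg)
    then show ?case by (simp add: mult_ac)
  qed simp
  then have "cmod (poly p z) \<le> cmod (lead_coeff p) * ((1 + cmod z) ^ length zs * (\<Prod>x\<leftarrow>zs. 1 + cmod x))"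
    unfolding norm by (intro mult_left_mono) auto
  also have "\<dots> = cmod (lead_coeff p) * (c ^ length zs * (\<Prod>x\<leftarrow>zs. 1 + cmod x)) * ((1 + cmod z) / c) ^ length zs"
    using c(1) by (simp add: power_divide)
  also have "\<dots> \<le> M * ((1 + cmod z) / c) ^ length zs"
  proof (rule mult_right_mono)
    obtain w where w: "w \<in> K" "c ^ length zs * (\<Prod>x\<leftarrow>zs. 1 + cmod x) \<le> (\<Prod>x\<leftarrow>zs. cmod (w - x))"
      using c(3) by blast
    then have "cmod (lead_coeff p) * (c ^ length zs * (\<Prod>x\<leftarrow>zs. 1 + cmod x)) \<le> cmod (poly p w)"
      unfolding norm by (intro mult_left_mono) auto
    then show "cmod (lead_coeff p) * (c ^ length zs * (\<Prod>x\<leftarrow>zs. 1 + cmod x)) \<le> M"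
      using p(2)[OF w(1)] by linarith
  qed (use c(1) in auto)
  \<comment> \<open>Raising the exponent from the degree to \<open>D\<close> is legitimate because
    \<open>c \<le> 1\<close> makes the base at least 1.\<close>
  also have "\<dots> \<le> M * ((1 + cmod z) / c) ^ D"
    using c M p(1) len by (intro mult_left_mono power_increasing) (auto simp: pos_le_divide_eq add_increasing2)
  finally show ?thesis .
qed

text \<open>The rate found at \<open>z\<close> is \<open>real n * ((1 + cmod z) / c) ^ d\<close>:
  \<open>n\<close> comes from the exhaustion and \<open>c\<close> from the compact set, and neither
  depends on \<open>i\<close>. Integer rates make the exhaustion countable.\<close>

lemma geometrically_bounded_everywhere:
  fixes p :: "'i \<Rightarrow> complex poly"
  assumes deg: "\<And>i. degree (p i) \<le> d * wt i"
    and cap: "log_capacity {z. \<exists>L. \<forall>i. cmod (poly (p i) z) \<le> L ^ wt i} > 0"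
  shows "\<exists>L. \<forall>i. cmod (poly (p i) z) \<le> L ^ wt i"
proof -
  define F where "F n = {z. \<forall>i. cmod (poly (p i) z) \<le> real n ^ wt i}" for n
  have sub: "{z. \<exists>L. \<forall>i. cmod (poly (p i) z) \<le> L ^ wt i} \<subseteq> (\<Union>n. F n)"
  proof clarify
    fix z and L :: real assume L: "\<forall>i. cmod (poly (p i) z) \<le> L ^ wt i"
    define n where "n = nat \<lceil>\<bar>L\<bar>\<rceil>"
    have n: "\<bar>L\<bar> \<le> real n" unfolding n_def by linarith
    have "cmod (poly (p i) z) \<le> real n ^ wt i" for i
    proof -
      have "cmod (poly (p i) z) \<le> L ^ wt i" using L by blast
      also have "\<dots> \<le> \<bar>L\<bar> ^ wt i" unfolding power_abs[symmetric] by (rule abs_ge_self)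
      also have "\<dots> \<le> real n ^ wt i" using n by (intro power_mono) auto
      finally show ?thesis .
    qed
    then show "z \<in> (\<Union>n. F n)" by (auto simp: F_def)
  qed
  have cl: "closed (F n)" for n
  proof -
    have "F n = (\<Inter>i. {z. cmod (poly (p i) z) \<le> real n ^ wt i})" by (auto simp: F_def)
    then show ?thesis by (auto intro!: closed_INT closed_Collect_le continuous_intros)
  qed
  have mono: "mono F"
  proof (rule monoI)
    fix a b :: nat assume "a \<le> b"
    then have "real a ^ k \<le> real b ^ k" for k by (intro power_mono) auto
    then show "F a \<subseteq> F b" unfolding F_def by (blast intro: order_trans)
  qed
  obtain K n \<mu> where K: "compact K" "K \<subseteq> F n" "finite_measure \<mu>" "sets \<mu> = sets borel" "emeasure \<mu> K > 0"
    "\<And>z. z \<in> K \<Longrightarrow> (\<integral>\<^sup>+w\<in>K. neg_log (cmod (z - w)) \<partial>\<mu>) \<le> of_nat n"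
    by (rule positive_capacity_bounded_potential[OF cap sub cl mono]) blast
  obtain c where c: "c > 0" "c \<le> 1"
    "\<forall>zs. \<exists>w\<in>K. c ^ length zs * (\<Prod>z\<leftarrow>zs. 1 + cmod z) \<le> (\<Prod>z\<leftarrow>zs. cmod (w - z))"
    by (rule exists_point_large_product[OF K(1,3-6)]) blast
  have "cmod (poly (p i) z) \<le> (real n * ((1 + cmod z) / c) ^ d) ^ wt i" for i
    using bernstein_walsh_of_large_product[OF c deg[of i], of "real n ^ wt i" z] K(2)
    by (auto simp: F_def power_mult_distrib power_mult)
  then show ?thesis by blast
qed

section \<open>Families of polynomials in several parameters\<close>

text \<open>A polynomial of degree at most \<open>D\<close> enters only through its restrictions to complex lines.\<close>

definition line_poly :: "nat \<Rightarrow> nat \<Rightarrow> (complex Matrix.vec \<Rightarrow> complex) \<Rightarrow> bool" where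
  "line_poly m D P \<longleftrightarrow> (\<forall>a\<in>carrier_vec m. \<forall>b\<in>carrier_vec m. \<exists>p. degree p \<le> D \<and> (\<forall>s. P (a + s \<cdot>\<^sub>v b) = poly p s))"

text \<open>The rate \<open>L\<close> may vary with \<open>t\<close> in any manner. For the
  coefficients of the formal linearization this is the set of parameters where it converges.\<close>

definition geometric_set :: "nat \<Rightarrow> ('i \<Rightarrow> nat) \<Rightarrow> ('i \<Rightarrow> complex Matrix.vec \<Rightarrow> complex) \<Rightarrow> complex Matrix.vec set" where
  "geometric_set m wt P = {t \<in> carrier_vec m. \<exists>L. \<forall>i. cmod (P i t) \<le> L ^ wt i}"

section \<open>Monotonicity of capacity and of the slicing operators\<close>

lemma log_capacity_mono: "E \<subseteq> E' \<Longrightarrow> log_capacity E \<le> log_capacity E'"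
  unfolding log_capacity_def by (rule SUP_subset_mono) (auto simp: compact_prob_measures_def)

lemma Gamma_slice_mono: "E \<subseteq> E' \<Longrightarrow> Gamma_slice k E \<subseteq> Gamma_slice k E'"
  unfolding Gamma_slice_def by (auto elim!: less_le_trans intro!: log_capacity_mono)

lemma Gamma_line_mono: "E \<subseteq> E' \<Longrightarrow> Gamma_line k E \<subseteq> Gamma_line k E'"
  by (induction k E arbitrary: E' rule: Gamma_line.induct) (auto dest: Gamma_slice_mono)

text \<open>A constant of its own, because the simplifier rewrites \<open>vec_of_list [w]\<close>
  with \<open>vec_of_list_Cons\<close> and loses the form used in
  \<open>Gamma_slice\<close>.\<close>

definition vec1 :: "complex \<Rightarrow> complex Matrix.vec" where
  "vec1 w = vec_of_list [w]"

lemma vec1_simps [simp]: "dim_vec (vec1 w) = 1" "vec_index (vec1 w) 0 = w"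
  by (simp_all add: vec1_def vec_of_list_index del: vec_of_list_Cons)

lemma Gamma_slice_vec1: "Gamma_slice k E = {z \<in> carrier_vec k. log_capacity {w. z @\<^sub>v vec1 w \<in> E} > 0}"
  unfolding Gamma_slice_def vec1_def ..

lemma Gamma_line_1: "Gamma_line (Suc 0) E = {w. vec1 w \<in> E}"
  unfolding Gamma_line.simps vec1_def ..

text \<open>Over a point \<open>z\<close> of the slice, the one-variable result puts the whole fibre
  into the set. Thus for each fixed \<open>w\<close> the slice lies in the geometric set of the
  functions \<open>P i (z @\<^sub>v vec1 w)\<close> of \<open>z\<close>, to which the induction
  hypothesis applies.\<close>

lemma geometric_set_eq_carrier:
  fixes P :: "'i \<Rightarrow> complex Matrix.vec \<Rightarrow> complex"
  assumes "\<And>i. line_poly (Suc k) (d * wt i) (P i)"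
    and "log_capacity (Gamma_line (Suc k) (geometric_set (Suc k) wt P)) > 0"
  shows "geometric_set (Suc k) wt P = carrier_vec (Suc k)"
  using assms
proof (induction k arbitrary: P)
  case 0
  define o1 :: "complex Matrix.vec" where "o1 = vec1 1"
  have carr: "0\<^sub>v 1 \<in> carrier_vec (Suc 0)" "o1 \<in> carrier_vec (Suc 0)" by (auto simp: o1_def intro!: carrier_vecI)
  have line: "vec1 w = 0\<^sub>v 1 + w \<cdot>\<^sub>v o1" for w :: complex
    by (rule eq_vecI) (auto simp: o1_def)
  have "\<exists>p. degree p \<le> d * wt i \<and> (\<forall>s. P i (0\<^sub>v 1 + s \<cdot>\<^sub>v o1) = poly p s)" for i
    using 0(1)[of i] carr unfolding line_poly_def by blast
  then obtain p where p: "\<And>i. degree (p i) \<le> d * wt i" "\<And>i s. P i (vec1 s) = poly (p i) s"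
    unfolding line by metis
  have "Gamma_line (Suc 0) (geometric_set (Suc 0) wt P) = {z. \<exists>L. \<forall>i. cmod (poly (p i) z) \<le> L ^ wt i}"
    unfolding Gamma_line_1 by (auto simp: geometric_set_def p(2) intro!: carrier_vecI)
  then have *: "\<exists>L. \<forall>i. cmod (poly (p i) z) \<le> L ^ wt i" for z
    using geometrically_bounded_everywhere[OF p(1)] 0(2) by simp
  show ?case
  proof
    show "carrier_vec (Suc 0) \<subseteq> geometric_set (Suc 0) wt P"
    proof
      fix t :: "complex Matrix.vec" assume t: "t \<in> carrier_vec (Suc 0)"
      then have "t = vec1 (vec_index t 0)" by (intro eq_vecI) auto
      then have "P i t = poly (p i) (vec_index t 0)" for i using p(2)[of i "vec_index t 0"] by simp
      then show "t \<in> geometric_set (Suc 0) wt P" using * t by (simp add: geometric_set_def)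
    qed
  qed (auto simp: geometric_set_def)
next
  case (Suc k)
  have lst: "vec1 w \<in> carrier_vec 1" for w :: complex by (rule carrier_vecI) simp
  have app: "z @\<^sub>v vec1 w \<in> carrier_vec (Suc (Suc k))" if "z \<in> carrier_vec (Suc k)" for z and w :: complex
    using append_carrier_vec[OF that lst] by simp
  let ?E = "geometric_set (Suc (Suc k)) wt P"
  have slice: "z @\<^sub>v vec1 w \<in> ?E" if z: "z \<in> Gamma_slice (Suc k) ?E" for z w
  proof -
    have zc: "z \<in> carrier_vec (Suc k)" and cap: "log_capacity {w. z @\<^sub>v vec1 w \<in> ?E} > 0"
      using z by (auto simp: Gamma_slice_vec1)
    have line: "z @\<^sub>v vec1 w = (z @\<^sub>v vec1 0) + w \<cdot>\<^sub>v (0\<^sub>v (Suc k) @\<^sub>v vec1 1)" for w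
      using zc by (intro eq_vecI) auto
    have "\<exists>p. degree p \<le> d * wt i \<and> (\<forall>w. P i ((z @\<^sub>v vec1 0) + w \<cdot>\<^sub>v (0\<^sub>v (Suc k) @\<^sub>v vec1 1)) = poly p w)" for i
      using Suc.prems(1)[of i] app[OF zc] app[OF zero_carrier_vec] unfolding line_poly_def by blast
    then obtain p where p: "\<And>i. degree (p i) \<le> d * wt i" "\<And>i w. P i (z @\<^sub>v vec1 w) = poly (p i) w"
      unfolding line[symmetric] by metis
    have "\<exists>L. \<forall>i. cmod (poly (p i) w) \<le> L ^ wt i"
      using cap app[OF zc] by (intro geometrically_bounded_everywhere[OF p(1)]) (simp add: geometric_set_def p(2))
    then show ?thesis using app[OF zc] by (simp add: geometric_set_def p(2))
  qed
  show ?case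
  proof
    show "carrier_vec (Suc (Suc k)) \<subseteq> ?E"
    proof
      fix t :: "complex Matrix.vec" assume t: "t \<in> carrier_vec (Suc (Suc k))"
      define w where "w = vec_index t (Suc k)"
      define z where "z = Matrix.vec (Suc k) (\<lambda>j. vec_index t j)"
      have zc: "z \<in> carrier_vec (Suc k)" by (simp add: z_def)
      have tz: "t = z @\<^sub>v vec1 w"
        using t by (intro eq_vecI) (auto simp: z_def w_def less_Suc_eq)
      let ?Q = "\<lambda>i z. P i (z @\<^sub>v vec1 w)"
      have "geometric_set (Suc k) wt ?Q = carrier_vec (Suc k)"
      proof (rule Suc.IH)
        show "line_poly (Suc k) (d * wt i) (?Q i)" for i
          unfolding line_poly_def
        proof (intro ballI)
          fix a b :: "complex Matrix.vec" assume ab: "a \<in> carrier_vec (Suc k)" "b \<in> carrier_vec (Suc k)"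
          have "(a + s \<cdot>\<^sub>v b) @\<^sub>v vec1 w = (a @\<^sub>v vec1 w) + s \<cdot>\<^sub>v (b @\<^sub>v vec1 0)" for s
            using ab by (intro eq_vecI) auto
          then show "\<exists>p. degree p \<le> d * wt i \<and> (\<forall>s. ?Q i (a + s \<cdot>\<^sub>v b) = poly p s)"
            using Suc.prems(1)[of i] app[OF ab(1)] app[OF ab(2)] unfolding line_poly_def by simp
        qed
        \<comment> \<open>This inclusion holds for every \<open>w\<close>, not only for those in a
          set of positive capacity, since the fibres over the slice are full.\<close>
        have "Gamma_slice (Suc k) ?E \<subseteq> geometric_set (Suc k) wt ?Q"
          using slice[of _ w] by (auto simp: geometric_set_def Gamma_slice_vec1)
        then have "log_capacity (Gamma_line (Suc (Suc k)) ?E) \<le> log_capacity (Gamma_line (Suc k) (geometric_set (Suc k) wt ?Q))"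
          by (simp add: log_capacity_mono Gamma_line_mono)
        then show "0 < log_capacity (Gamma_line (Suc k) (geometric_set (Suc k) wt ?Q))"
          using Suc.prems(2) by (rule less_le_trans[rotated])
      qed
      then have "z \<in> geometric_set (Suc k) wt ?Q" using zc by simp
      then show "t \<in> ?E" using t unfolding tz by (simp add: geometric_set_def)
    qed
  qed (auto simp: geometric_set_def)
qed

text \<open>If the capacity is positive after some unitary \<open>U\<close>, compose the functions
  with the inverse of \<open>U\<close>. Linear maps send lines to lines, so the degree bounds along
  lines persist, and filling the space in the new coordinates fills it in the old ones.\<close>

theorem geometric_set_dichotomy:
  fixes P :: "'i \<Rightarrow> complex Matrix.vec \<Rightarrow> complex"
  assumes m: "m \<ge> 1" and P: "\<And>i. line_poly m (d * wt i) (P i)"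
  shows "geometric_set m wt P = carrier_vec m \<or> Gamma_capacity m (geometric_set m wt P) = 0"
proof (cases "Gamma_capacity m (geometric_set m wt P) = 0")
  case False
  let ?E = "geometric_set m wt P"
  have "Gamma_capacity m ?E > 0" using False by (simp add: zero_less_iff_neq_zero)
  then obtain U where U: "U \<in> unitary_mats m" and cap: "log_capacity (Gamma_line m ((\<lambda>t. U *\<^sub>v t) ` ?E)) > 0"
    unfolding Gamma_capacity_def less_SUP_iff by blast
  define V where "V = mat_adjoint U"
  have Uc: "U \<in> carrier_mat m m" and UV: "U * V = 1\<^sub>m m" "V * U = 1\<^sub>m m"
    using U by (auto simp: unitary_mats_def V_def)
  have Vc: "V \<in> carrier_mat m m"
    using arg_cong[OF UV(2), of dim_row] arg_cong[OF UV(1), of dim_col] by (intro carrier_matI) simp_all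
  have VU: "V *\<^sub>v (U *\<^sub>v t) = t" "U *\<^sub>v (V *\<^sub>v t) = t" if "t \<in> carrier_vec m" for t
    using assoc_mult_mat_vec[OF Vc Uc that] assoc_mult_mat_vec[OF Uc Vc that] that by (simp_all add: UV)
  let ?Q = "\<lambda>i t. P i (V *\<^sub>v t)"
  obtain k where k: "m = Suc k" using m by (cases m) auto
  have "geometric_set m wt ?Q = carrier_vec m"
    unfolding k
  proof (rule geometric_set_eq_carrier)
    show "line_poly (Suc k) (d * wt i) (?Q i)" for i
      unfolding line_poly_def k[symmetric]
    proof (intro ballI)
      fix a b :: "complex Matrix.vec" assume ab: "a \<in> carrier_vec m" "b \<in> carrier_vec m"
      have "V *\<^sub>v (a + s \<cdot>\<^sub>v b) = V *\<^sub>v a + s \<cdot>\<^sub>v (V *\<^sub>v b)" for s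
        using ab Vc by (simp add: mult_add_distrib_mat_vec mult_mat_vec)
      then show "\<exists>p. degree p \<le> d * wt i \<and> (\<forall>s. ?Q i (a + s \<cdot>\<^sub>v b) = poly p s)"
        using P[of i] ab Vc unfolding line_poly_def by simp
    qed
    have "(\<lambda>t. U *\<^sub>v t) ` ?E \<subseteq> geometric_set m wt ?Q"
    proof (rule image_subsetI)
      fix t assume "t \<in> ?E"
      then show "U *\<^sub>v t \<in> geometric_set m wt ?Q" using Uc by (simp add: geometric_set_def VU(1))
    qed
    then show "0 < log_capacity (Gamma_line (Suc k) (geometric_set (Suc k) wt ?Q))"
      using cap unfolding k[symmetric] by (auto elim!: less_le_trans intro!: log_capacity_mono Gamma_line_mono)
  qed
  moreover have "t \<in> ?E" if t: "t \<in> carrier_vec m" "geometric_set m wt ?Q = carrier_vec m" for t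
  proof -
    have "U *\<^sub>v t \<in> geometric_set m wt ?Q" using t Uc by simp
    then show ?thesis using VU(1)[OF t(1)] t(1) by (simp add: geometric_set_def)
  qed
  ultimately show ?thesis by (auto simp: geometric_set_def)
qed simp

section \<open>The formal linearization\<close>

definition unit_ix :: "'n \<Rightarrow> 'n \<Rightarrow> nat" where
  "unit_ix l = (\<lambda>_. 0)(l := 1)"

lemma unit_ix_inject [simp]: "unit_ix j = unit_ix l \<longleftrightarrow> j = l"
  unfolding unit_ix_def by (metis fun_upd_apply zero_neq_one)

lemma mdeg_unit_ix [simp]: "mdeg (unit_ix l) = 1"
  using mdeg_upd[of "\<lambda>_. 0" l 1] by (simp add: unit_ix_def)

lemma unit_ix_neq_0 [simp]: "unit_ix l \<noteq> (\<lambda>_. 0)"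
  by (auto simp: unit_ix_def fun_eq_iff)

lemma mono_at_unit_ix [simp]: "mono_at z (unit_ix l) = z $ l"
  using mono_at_upd[of "\<lambda>_. 0" l z 1] by (simp add: unit_ix_def)

lemma mdeg_le_1_cases:
  assumes "mdeg \<kappa> \<le> 1"
  obtains "\<kappa> = (\<lambda>_. 0)" | l where "\<kappa> = unit_ix l"
proof (cases "\<kappa> = (\<lambda>_. 0)")
  case False
  then obtain l where l: "\<kappa> l > 0" by auto
  then have "mdeg (\<kappa>(l := 0)) = 0" "\<kappa> l = 1" using mdeg_upd[of \<kappa> l 0] assms by auto
  then have "\<kappa>(l := 0) = (\<lambda>_. 0)" by (simp add: mdeg_eq_0_iff)
  then have "\<kappa> = unit_ix l" using \<open>\<kappa> l = 1\<close> unfolding unit_ix_def by (metis fun_upd_triv fun_upd_upd)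
  then show ?thesis by (rule that(2))
qed (rule that(1))

lemma conv_series_unit: "conv_series (\<lambda>\<kappa>. if \<kappa> = unit_ix l then c else 0)"
  by (rule conv_seriesI[where C = "cmod c" and R = 1]) auto

lemma pseries_unit: "pseries (\<lambda>\<kappa>. if \<kappa> = unit_ix l then c else 0) z = c * z $ l"
proof -
  have "pseries (\<lambda>\<kappa>. if \<kappa> = unit_ix l then c else 0) z =
      (\<Sum>\<^sub>\<infinity>\<kappa>\<in>{unit_ix l}. (if \<kappa> = unit_ix l then c else 0) * mono_at z \<kappa>)"
    unfolding pseries_def by (rule infsum_cong_neutral) auto
  then show ?thesis by simp
qed

lemma pd_at_0: "pd l c (\<lambda>_. 0) = c (unit_ix l)"
  by (simp add: pd_def unit_ix_def)

lemma series_first_order: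
  fixes g :: "complex ^ 'n \<Rightarrow> complex"
  assumes c: "conv_series c" and eq: "\<forall>\<^sub>F z in nhds 0. g z = pseries c z"
  shows "c (\<lambda>_. 0) = g 0" and "(g has_derivative D) (at 0) \<Longrightarrow> c (unit_ix l) = D (axis l 1)"
proof -
  show g0: "c (\<lambda>_. 0) = g 0" using eventually_nhds_x_imp_x[OF eq] by (simp add: pseries_at_0)
  assume D: "(g has_derivative D) (at 0)"
  have "(pseries c has_derivative (\<lambda>v. \<Sum>l\<in>UNIV. v $ l * pseries (pd l c) 0)) (at 0)"
    by (rule eventually_nhds_x_imp_x[OF pseries_has_derivative[OF c]])
  then have "(g has_derivative (\<lambda>v. \<Sum>l\<in>UNIV. v $ l * pseries (pd l c) 0)) (at 0)"
  proof (rule has_derivative_transform_eventually)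
    show "\<forall>\<^sub>F z in at 0. pseries c z = g z"
      unfolding eventually_at_filter using eq by (rule eventually_mono) simp
  qed (use g0 in \<open>auto simp: pseries_at_0\<close>)
  then have "D = (\<lambda>v. \<Sum>l\<in>UNIV. v $ l * pseries (pd l c) 0)" by (rule has_derivative_unique[OF D])
  then show "c (unit_ix l) = D (axis l 1)"
    by (simp add: pseries_at_0 pd_at_0 axis_def if_distrib[of "\<lambda>x. x * _"] cong: if_cong)
qed

text \<open>The linearizing map \<open>h\<close> is determined coefficientwise by \<open>Dh \<cdot> X = \<Lambda> h\<close>. Since this equation is
  linear in \<open>h\<close>, the coefficients of \<open>h\<close> of degree \<open>k\<close> are polynomials of degree at most \<open>k - 1\<close> in
  those of the nonlinear part \<open>A\<close> of \<open>X\<close>.\<close>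

function formal_lin :: "('n::finite \<Rightarrow> complex) \<Rightarrow> ('n \<Rightarrow> ('n \<Rightarrow> nat) \<Rightarrow> complex) \<Rightarrow> 'n \<Rightarrow> ('n \<Rightarrow> nat) \<Rightarrow> complex" where
  "formal_lin lam A j \<kappa> = (if mdeg \<kappa> \<le> 1 then (if \<kappa> = unit_ix j then 1 else 0)
     else - (\<Sum>l\<in>UNIV. \<Sum>\<alpha>\<in>{\<alpha>. (\<forall>i. \<alpha> i \<le> \<kappa> i) \<and> mdeg \<alpha> + 2 \<le> mdeg \<kappa>}.
                of_nat (Suc (\<alpha> l)) * formal_lin lam A j (\<alpha>(l := Suc (\<alpha> l))) * A l (\<lambda>i. \<kappa> i - \<alpha> i))
            / ((\<Sum>k\<in>UNIV. of_nat (\<kappa> k) * lam k) - lam j))"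
  by pat_completeness auto
termination
  by (relation "Wellfounded.measure (\<lambda>(lam, A, j, \<kappa>). mdeg \<kappa>)") auto

declare formal_lin.simps [simp del]

definition field_series :: "('n::finite \<Rightarrow> complex) \<Rightarrow> ('n \<Rightarrow> ('n \<Rightarrow> nat) \<Rightarrow> complex) \<Rightarrow> 'n \<Rightarrow> ('n \<Rightarrow> nat) \<Rightarrow> complex" where
  "field_series lam A l \<kappa> = (if \<kappa> = unit_ix l then lam l else 0) + A l \<kappa>"

text \<open>The Euler field \<open>c z_l \<partial>/\<partial>z_l\<close> acts on the monomial of
  exponent \<open>\<kappa>\<close> by the scalar \<open>c \<kappa>_l\<close>.\<close>

lemma cauchy_prod_unit:
  "cauchy_prod (pd l h) (\<lambda>\<kappa>. if \<kappa> = unit_ix l then c else 0) \<kappa> = of_nat (\<kappa> l) * c * h \<kappa>"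
proof (cases "\<kappa> l = 0")
  case True
  have "(\<lambda>i. \<kappa> i - \<alpha> i) \<noteq> unit_ix l" for \<alpha>
    using True by (auto simp: unit_ix_def fun_eq_iff intro!: exI[of _ l])
  then show ?thesis using True by (simp add: cauchy_prod_def)
next
  case False
  let ?\<alpha> = "\<kappa>(l := \<kappa> l - 1)"
  have iff: "(\<lambda>i. \<kappa> i - \<alpha> i) = unit_ix l \<longleftrightarrow> \<alpha> = ?\<alpha>" if "\<forall>i. \<alpha> i \<le> \<kappa> i" for \<alpha>
  proof
    assume eq: "(\<lambda>i. \<kappa> i - \<alpha> i) = unit_ix l"
    show "\<alpha> = ?\<alpha>"
    proof
      fix i
      have "\<kappa> i - \<alpha> i = unit_ix l i" using fun_cong[OF eq] .
      then show "\<alpha> i = ?\<alpha> i" using that[rule_format, of i] by (auto simp: unit_ix_def split: if_splits)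
    qed
  next
    assume "\<alpha> = ?\<alpha>"
    then show "(\<lambda>i. \<kappa> i - \<alpha> i) = unit_ix l" using False by (auto simp: unit_ix_def fun_eq_iff)
  qed
  have "cauchy_prod (pd l h) (\<lambda>\<kappa>. if \<kappa> = unit_ix l then c else 0) \<kappa> =
      (\<Sum>\<alpha>\<in>{\<alpha>. \<forall>i. \<alpha> i \<le> \<kappa> i}. if \<alpha> = ?\<alpha> then pd l h \<alpha> * c else 0)"
    unfolding cauchy_prod_def using iff by (intro sum.cong) auto
  also have "\<dots> = pd l h ?\<alpha> * c" by (simp add: sum.delta)
  also have "Suc (\<kappa> l - 1) = \<kappa> l" using False by simp
  then have "pd l h ?\<alpha> = of_nat (\<kappa> l) * h \<kappa>" by (simp add: pd_def del: of_nat_Suc)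
  finally show ?thesis by simp
qed

text \<open>Only \<open>\<alpha>\<close> with \<open>\<kappa> - \<alpha>\<close> of degree at least
  2 contribute. This is the index set in \<open>formal_lin\<close>, and it makes the recursion there
  descend in degree.\<close>

lemma cauchy_prod_order_2:
  assumes "\<And>\<beta>. mdeg \<beta> \<le> 1 \<Longrightarrow> b \<beta> = 0"
  shows "cauchy_prod a b \<kappa> =
    (\<Sum>\<alpha>\<in>{\<alpha>. (\<forall>i. \<alpha> i \<le> \<kappa> i) \<and> mdeg \<alpha> + 2 \<le> mdeg \<kappa>}. a \<alpha> * b (\<lambda>i. \<kappa> i - \<alpha> i))"
  unfolding cauchy_prod_def
proof (rule sum.mono_neutral_right)
  show "\<forall>\<alpha>\<in>{\<alpha>. \<forall>l. \<alpha> l \<le> \<kappa> l} - {\<alpha>. (\<forall>i. \<alpha> i \<le> \<kappa> i) \<and> mdeg \<alpha> + 2 \<le> mdeg \<kappa>}.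
      a \<alpha> * b (\<lambda>i. \<kappa> i - \<alpha> i) = 0"
  proof
    fix \<alpha> assume "\<alpha> \<in> {\<alpha>. \<forall>l. \<alpha> l \<le> \<kappa> l} - {\<alpha>. (\<forall>i. \<alpha> i \<le> \<kappa> i) \<and> mdeg \<alpha> + 2 \<le> mdeg \<kappa>}"
    then have "\<forall>l. \<alpha> l \<le> \<kappa> l" "mdeg \<kappa> < mdeg \<alpha> + 2" by auto
    with mdeg_diff[of \<alpha> \<kappa>] have "mdeg (\<lambda>i. \<kappa> i - \<alpha> i) \<le> 1" by auto
    then show "a \<alpha> * b (\<lambda>i. \<kappa> i - \<alpha> i) = 0" by (simp add: assms)
  qed
qed auto

lemma cauchy_prod_add_right: "cauchy_prod a (\<lambda>\<kappa>. b \<kappa> + c \<kappa>) \<kappa> = cauchy_prod a b \<kappa> + cauchy_prod a c \<kappa>"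
  by (simp add: cauchy_prod_def distrib_left sum.distrib)

text \<open>The homological equation: the linear part of the field is diagonal on monomials with
  eigenvalue \<open>\<Sum>k\<in>UNIV. of_nat (\<kappa> k) * lam k\<close>, and what remains involves
  coefficients of \<open>h\<close> of degree below \<open>mdeg \<kappa>\<close>.\<close>

lemma linearization_equation_coeff:
  assumes A: "\<And>l \<beta>. mdeg \<beta> \<le> 1 \<Longrightarrow> A l \<beta> = 0"
  shows "(\<Sum>l\<in>UNIV. cauchy_prod (pd l h) (field_series lam A l) \<kappa>) = lam j * h \<kappa> \<longleftrightarrow>
    ((\<Sum>k\<in>UNIV. of_nat (\<kappa> k) * lam k) - lam j) * h \<kappa> =
      - (\<Sum>l\<in>UNIV. \<Sum>\<alpha>\<in>{\<alpha>. (\<forall>i. \<alpha> i \<le> \<kappa> i) \<and> mdeg \<alpha> + 2 \<le> mdeg \<kappa>}.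
                of_nat (Suc (\<alpha> l)) * h (\<alpha>(l := Suc (\<alpha> l))) * A l (\<lambda>i. \<kappa> i - \<alpha> i))"
proof -
  define T where "T = (\<Sum>l\<in>UNIV. \<Sum>\<alpha>\<in>{\<alpha>. (\<forall>i. \<alpha> i \<le> \<kappa> i) \<and> mdeg \<alpha> + 2 \<le> mdeg \<kappa>}.
                of_nat (Suc (\<alpha> l)) * h (\<alpha>(l := Suc (\<alpha> l))) * A l (\<lambda>i. \<kappa> i - \<alpha> i))"
  have "(\<Sum>l\<in>UNIV. cauchy_prod (pd l h) (field_series lam A l) \<kappa>) =
      (\<Sum>l\<in>UNIV. of_nat (\<kappa> l) * lam l * h \<kappa>) + (\<Sum>l\<in>UNIV. cauchy_prod (pd l h) (A l) \<kappa>)"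
    unfolding field_series_def[abs_def] by (simp add: cauchy_prod_add_right cauchy_prod_unit sum.distrib)
  also have "(\<Sum>l\<in>UNIV. cauchy_prod (pd l h) (A l) \<kappa>) = T"
    unfolding T_def by (intro sum.cong refl, subst cauchy_prod_order_2) (auto simp: A pd_def)
  also have "(\<Sum>l\<in>UNIV. of_nat (\<kappa> l) * lam l * h \<kappa>) = (\<Sum>k\<in>UNIV. of_nat (\<kappa> k) * lam k) * h \<kappa>"
    by (simp add: sum_distrib_right)
  finally have "(\<Sum>l\<in>UNIV. cauchy_prod (pd l h) (field_series lam A l) \<kappa>) =
      (\<Sum>k\<in>UNIV. of_nat (\<kappa> k) * lam k) * h \<kappa> + T" .
  then show ?thesis unfolding T_def[symmetric]
    by (simp add: left_diff_distrib eq_neg_iff_add_eq_0 diff_add_eq)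
qed

lemma formal_lin_low: "mdeg \<kappa> \<le> 1 \<Longrightarrow> formal_lin lam A j \<kappa> = (if \<kappa> = unit_ix j then 1 else 0)"
  by (subst formal_lin.simps) simp

lemma small_divisor_nonzero:
  "non_resonant lam \<Longrightarrow> 2 \<le> mdeg \<kappa> \<Longrightarrow> (\<Sum>k\<in>UNIV. of_nat (\<kappa> k) * lam k) - lam j \<noteq> 0"
  by (simp add: non_resonant_def mdeg_def)

lemma formal_lin_equation:
  assumes "non_resonant lam" and A: "\<And>l \<beta>. mdeg \<beta> \<le> 1 \<Longrightarrow> A l \<beta> = 0"
  shows "(\<Sum>l\<in>UNIV. cauchy_prod (pd l (formal_lin lam A j)) (field_series lam A l) \<kappa>) = lam j * formal_lin lam A j \<kappa>"
proof (rule linearization_equation_coeff[where A = A and lam = lam and j = j, OF A, THEN iffD2], assumption, cases "mdeg \<kappa> \<le> 1")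
  case True
  then have empty: "{\<alpha>. (\<forall>i. \<alpha> i \<le> \<kappa> i) \<and> mdeg \<alpha> + 2 \<le> mdeg \<kappa>} = {}" by auto
  \<comment> \<open>In degree at most 1 the coefficient vanishes except at \<open>unit_ix j\<close>,
    and there the divisor is \<open>lam j - lam j\<close>.\<close>
  have zero: "((\<Sum>k\<in>UNIV. of_nat (\<kappa> k) * lam k) - lam j) * formal_lin lam A j \<kappa> = 0"
    by (auto simp: formal_lin_low[OF True] unit_ix_def if_distrib[of of_nat] if_distrib[of "\<lambda>x. x * _"] cong: if_cong)
  show "((\<Sum>k\<in>UNIV. of_nat (\<kappa> k) * lam k) - lam j) * formal_lin lam A j \<kappa> =
      - (\<Sum>l\<in>UNIV. \<Sum>\<alpha>\<in>{\<alpha>. (\<forall>i. \<alpha> i \<le> \<kappa> i) \<and> mdeg \<alpha> + 2 \<le> mdeg \<kappa>}.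
                of_nat (Suc (\<alpha> l)) * formal_lin lam A j (\<alpha>(l := Suc (\<alpha> l))) * A l (\<lambda>i. \<kappa> i - \<alpha> i))"
    unfolding empty zero by simp
next
  case False
  then show "((\<Sum>k\<in>UNIV. of_nat (\<kappa> k) * lam k) - lam j) * formal_lin lam A j \<kappa> =
      - (\<Sum>l\<in>UNIV. \<Sum>\<alpha>\<in>{\<alpha>. (\<forall>i. \<alpha> i \<le> \<kappa> i) \<and> mdeg \<alpha> + 2 \<le> mdeg \<kappa>}.
                of_nat (Suc (\<alpha> l)) * formal_lin lam A j (\<alpha>(l := Suc (\<alpha> l))) * A l (\<lambda>i. \<kappa> i - \<alpha> i))"
    using small_divisor_nonzero[OF assms(1), of \<kappa> j] by (subst formal_lin.simps) simp
qed

text \<open>The divisor vanishes at \<open>unit_ix j\<close>, so tangency to the identity has to fix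
  the coefficients of degree at most 1; from degree 2 on, non-resonance determines them
  recursively.\<close>

lemma formal_lin_unique:
  assumes "non_resonant lam" and A: "\<And>l \<beta>. mdeg \<beta> \<le> 1 \<Longrightarrow> A l \<beta> = 0"
    and low: "\<And>\<kappa>. mdeg \<kappa> \<le> 1 \<Longrightarrow> h \<kappa> = (if \<kappa> = unit_ix j then 1 else 0)"
    and eq: "\<And>\<kappa>. (\<Sum>l\<in>UNIV. cauchy_prod (pd l h) (field_series lam A l) \<kappa>) = lam j * h \<kappa>"
  shows "h \<kappa> = formal_lin lam A j \<kappa>"
proof (induction "mdeg \<kappa>" arbitrary: \<kappa> rule: less_induct)
  case less
  show ?case
  proof (cases "mdeg \<kappa> \<le> 1")
    case True
    then show ?thesis by (simp add: low formal_lin_low)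
  next
    case False
    let ?I = "{\<alpha>. (\<forall>i. \<alpha> i \<le> \<kappa> i) \<and> mdeg \<alpha> + 2 \<le> mdeg \<kappa>}"
    let ?s = "(\<Sum>k\<in>UNIV. of_nat (\<kappa> k) * lam k) - lam j"
    have "?s * h \<kappa> = - (\<Sum>l\<in>UNIV. \<Sum>\<alpha>\<in>?I. of_nat (Suc (\<alpha> l)) * h (\<alpha>(l := Suc (\<alpha> l))) * A l (\<lambda>i. \<kappa> i - \<alpha> i))"
      by (rule linearization_equation_coeff[where A = A, OF A, THEN iffD1, OF _ eq[of \<kappa>]])
    also have "\<dots> = - (\<Sum>l\<in>UNIV. \<Sum>\<alpha>\<in>?I. of_nat (Suc (\<alpha> l)) * formal_lin lam A j (\<alpha>(l := Suc (\<alpha> l))) * A l (\<lambda>i. \<kappa> i - \<alpha> i))"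
      by (intro arg_cong[where f = uminus] sum.cong refl) (simp add: less)
    also have "\<dots> = ?s * formal_lin lam A j \<kappa>"
      by (rule linearization_equation_coeff[where A = A, OF A, THEN iffD1, OF _ formal_lin_equation[OF assms(1) A], symmetric])
    finally show ?thesis using small_divisor_nonzero[OF assms(1), of \<kappa> j] False by simp
  qed
qed

section \<open>Degrees along complex lines\<close>

lemma line_poly_const: "line_poly m D (\<lambda>_. c)"
  unfolding line_poly_def by (auto intro!: exI[of _ "[:c:]"])

lemma line_poly_mono: "line_poly m D P \<Longrightarrow> D \<le> D' \<Longrightarrow> line_poly m D' P"
  unfolding line_poly_def by (meson order_trans)

lemma line_poly_mult:
  assumes "line_poly m D P" "line_poly m D' Q"
  shows "line_poly m (D + D') (\<lambda>t. P t * Q t)"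
  unfolding line_poly_def
proof (intro ballI)
  fix a b :: "complex Matrix.vec" assume ab: "a \<in> carrier_vec m" "b \<in> carrier_vec m"
  obtain p where p: "degree p \<le> D" "\<And>s. P (a + s \<cdot>\<^sub>v b) = poly p s"
    using assms(1) ab unfolding line_poly_def by blast
  obtain q where q: "degree q \<le> D'" "\<And>s. Q (a + s \<cdot>\<^sub>v b) = poly q s"
    using assms(2) ab unfolding line_poly_def by blast
  show "\<exists>r. degree r \<le> D + D' \<and> (\<forall>s. P (a + s \<cdot>\<^sub>v b) * Q (a + s \<cdot>\<^sub>v b) = poly r s)"
    using order_trans[OF degree_mult_le add_mono[OF p(1) q(1)]] by (intro exI[of _ "p * q"]) (simp add: p(2) q(2))
qed

lemma line_poly_add:
  assumes "line_poly m D P" "line_poly m D Q"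
  shows "line_poly m D (\<lambda>t. P t + Q t)"
  unfolding line_poly_def
proof (intro ballI)
  fix a b :: "complex Matrix.vec" assume ab: "a \<in> carrier_vec m" "b \<in> carrier_vec m"
  obtain p where p: "degree p \<le> D" "\<And>s. P (a + s \<cdot>\<^sub>v b) = poly p s"
    using assms(1) ab unfolding line_poly_def by blast
  obtain q where q: "degree q \<le> D" "\<And>s. Q (a + s \<cdot>\<^sub>v b) = poly q s"
    using assms(2) ab unfolding line_poly_def by blast
  show "\<exists>r. degree r \<le> D \<and> (\<forall>s. P (a + s \<cdot>\<^sub>v b) + Q (a + s \<cdot>\<^sub>v b) = poly r s)"
    using degree_add_le[OF p(1) q(1)] by (intro exI[of _ "p + q"]) (simp add: p(2) q(2))
qed

lemma line_poly_sum: "(\<And>i. i \<in> I \<Longrightarrow> line_poly m D (P i)) \<Longrightarrow> line_poly m D (\<lambda>t. \<Sum>i\<in>I. P i t)"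
  by (induction I rule: infinite_finite_induct) (auto intro: line_poly_add line_poly_const)

lemma line_poly_cmult: "line_poly m D P \<Longrightarrow> line_poly m D (\<lambda>t. c * P t)"
  using line_poly_mult[OF line_poly_const[of m 0 c]] by fastforce

lemma line_poly_prod:
  "finite I \<Longrightarrow> (\<And>i. i \<in> I \<Longrightarrow> line_poly m (D i) (P i)) \<Longrightarrow> line_poly m (\<Sum>i\<in>I. D i) (\<lambda>t. \<Prod>i\<in>I. P i t)"
  by (induction I rule: finite_induct) (auto intro: line_poly_mult line_poly_const)

lemma line_poly_power: "line_poly m D P \<Longrightarrow> line_poly m (k * D) (\<lambda>t. P t ^ k)"
  using line_poly_prod[of "{..<k}" m "\<lambda>_. D" "\<lambda>_. P"] by simp

lemma line_poly_nth: "k < m \<Longrightarrow> line_poly m 1 (\<lambda>t. vec_index t k)"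
  unfolding line_poly_def
proof (intro ballI)
  fix a b :: "complex Matrix.vec" assume "k < m" "a \<in> carrier_vec m" "b \<in> carrier_vec m"
  then show "\<exists>p. degree p \<le> 1 \<and> (\<forall>s. vec_index (a + s \<cdot>\<^sub>v b) k = poly p s)"
    by (intro exI[of _ "[:vec_index a k, vec_index b k:]"]) auto
qed

lemma line_poly_monomial_vec:
  assumes "i \<in> multi_indices m d"
  shows "line_poly m d (\<lambda>t. monomial_vec m t i)"
proof (rule line_poly_mono)
  show "line_poly m (\<Sum>k<m. vec_index i k * 1) (\<lambda>t. monomial_vec m t i)"
    unfolding monomial_vec_def by (intro line_poly_prod line_poly_power line_poly_nth) auto
qed (use assms in \<open>auto simp: multi_indices_def\<close>)

text \<open>Each step of the recursion brings in one factor \<open>A\<close>, of degree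
  \<open>d\<close>, and uses a coefficient of total degree \<open>mdeg \<alpha> + 1\<close>, where
  \<open>mdeg \<alpha> + 2 \<le> mdeg \<kappa>\<close>. Division by a number independent of
  \<open>t\<close> does not affect the degree.\<close>

lemma line_poly_formal_lin:
  assumes A: "\<And>l \<beta>. line_poly m d (\<lambda>t. A t l \<beta>)"
  shows "line_poly m (d * mdeg \<kappa>) (\<lambda>t. formal_lin lam (A t) j \<kappa>)"
proof (induction "mdeg \<kappa>" arbitrary: \<kappa> rule: less_induct)
  case less
  show ?case
  proof (cases "mdeg \<kappa> \<le> 1")
    case True
    then show ?thesis by (simp add: formal_lin_low line_poly_const)
  next
    case False
    have summand: "line_poly m (d * mdeg \<kappa>)
        (\<lambda>t. of_nat (Suc (\<alpha> l)) * formal_lin lam (A t) j (\<alpha>(l := Suc (\<alpha> l))) * A t l (\<lambda>i. \<kappa> i - \<alpha> i))"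
      if "mdeg \<alpha> + 2 \<le> mdeg \<kappa>" for \<alpha> l
    proof (rule line_poly_mono)
      show "line_poly m (d * mdeg (\<alpha>(l := Suc (\<alpha> l))) + d)
          (\<lambda>t. of_nat (Suc (\<alpha> l)) * formal_lin lam (A t) j (\<alpha>(l := Suc (\<alpha> l))) * A t l (\<lambda>i. \<kappa> i - \<alpha> i))"
        using that by (intro line_poly_mult line_poly_cmult less A) auto
      have "d * (mdeg \<alpha> + 2) \<le> d * mdeg \<kappa>" using that by (rule mult_le_mono2)
      then show "d * mdeg (\<alpha>(l := Suc (\<alpha> l))) + d \<le> d * mdeg \<kappa>" by simp
    qed
    let ?s = "(\<Sum>k\<in>UNIV. of_nat (\<kappa> k) * lam k) - lam j"
    have "line_poly m (d * mdeg \<kappa>) (\<lambda>t. (- 1 / ?s) *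
        (\<Sum>l\<in>UNIV. \<Sum>\<alpha>\<in>{\<alpha>. (\<forall>i. \<alpha> i \<le> \<kappa> i) \<and> mdeg \<alpha> + 2 \<le> mdeg \<kappa>}.
          of_nat (Suc (\<alpha> l)) * formal_lin lam (A t) j (\<alpha>(l := Suc (\<alpha> l))) * A t l (\<lambda>i. \<kappa> i - \<alpha> i)))"
      by (intro line_poly_cmult line_poly_sum summand) auto
    then show ?thesis using False by (subst formal_lin.simps) simp
  qed
qed

section \<open>Linearizability and convergence of the formal linearization\<close>

lemma vec_lambda_eq_sum_axis: "(\<chi> j. x j) = (\<Sum>j\<in>UNIV. axis j (x j :: complex))"
  by (simp add: Finite_Cartesian_Product.vec_eq_iff axis_def if_distrib[of "\<lambda>v. v $ _"] cong: if_cong)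

lemma has_derivative_vec_lambda:
  fixes f :: "'n::finite \<Rightarrow> 'a::real_normed_vector \<Rightarrow> complex"
  assumes "\<And>j. (f j has_derivative f' j) F"
  shows "((\<lambda>z. \<chi> j. f j z) has_derivative (\<lambda>v. \<chi> j. f' j v)) F"
  unfolding vec_lambda_eq_sum_axis
  by (intro has_derivative_sum bounded_linear.has_derivative[OF bounded_linear_axis] assms)

lemma linearization_operator_series:
  assumes c: "conv_series c" and X: "\<And>l. conv_series (Y l)"
  shows "conv_series (\<lambda>\<kappa>. \<Sum>l\<in>UNIV. cauchy_prod (pd l c) (Y l) \<kappa>)"
    and "\<forall>\<^sub>F z in nhds 0. pseries (\<lambda>\<kappa>. \<Sum>l\<in>UNIV. cauchy_prod (pd l c) (Y l) \<kappa>) z =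
       (\<Sum>l\<in>UNIV. pseries (Y l) z * pseries (pd l c) z)"
proof -
  note cp = conv_series_cauchy_prod[OF conv_series_pd[OF c] X]
  have s: "conv_series (\<lambda>\<kappa>. \<Sum>l\<in>UNIV. cauchy_prod (pd l c) (Y l) \<kappa>) \<and>
     (\<forall>\<^sub>F z in nhds 0. pseries (\<lambda>\<kappa>. \<Sum>l\<in>UNIV. cauchy_prod (pd l c) (Y l) \<kappa>) z =
       (\<Sum>l\<in>UNIV. pseries (cauchy_prod (pd l c) (Y l)) z))"
    by (rule conv_series_sum) (auto intro: cp(1))
  show "conv_series (\<lambda>\<kappa>. \<Sum>l\<in>UNIV. cauchy_prod (pd l c) (Y l) \<kappa>)" using s by blast
  have "\<forall>\<^sub>F z in nhds 0. \<forall>l. pseries (cauchy_prod (pd l c) (Y l)) z = pseries (pd l c) z * pseries (Y l) z"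
    by (intro eventually_all_finite cp(2))
  moreover have "\<forall>\<^sub>F z in nhds 0. pseries (\<lambda>\<kappa>. \<Sum>l\<in>UNIV. cauchy_prod (pd l c) (Y l) \<kappa>) z =
       (\<Sum>l\<in>UNIV. pseries (cauchy_prod (pd l c) (Y l)) z)" using s by blast
  ultimately show "\<forall>\<^sub>F z in nhds 0. pseries (\<lambda>\<kappa>. \<Sum>l\<in>UNIV. cauchy_prod (pd l c) (Y l) \<kappa>) z =
       (\<Sum>l\<in>UNIV. pseries (Y l) z * pseries (pd l c) z)"
    by eventually_elim (simp add: mult.commute)
qed

lemma linear_inv_complex:
  fixes F :: "complex ^ 'n \<Rightarrow> complex ^ 'n"
  assumes "bij F" "\<And>c v. F (c *s v) = c *s F v"
  shows "inv_into UNIV F (c *s v) = c *s inv_into UNIV F v"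
  using assms by (metis bij_inv_eq_iff)

text \<open>The real inverse function theorem applies since the derivative is continuous near 0 and
  the identity at 0. The local inverse is holomorphic because the inverse of a complex-linear
  bijection is complex-linear.\<close>

lemma biholomorphic_germ_of_power_series:
  fixes H :: "'n::finite \<Rightarrow> ('n \<Rightarrow> nat) \<Rightarrow> complex"
  assumes conv: "\<And>j. conv_series (H j)"
    and low: "\<And>j \<kappa>. mdeg \<kappa> \<le> 1 \<Longrightarrow> H j \<kappa> = (if \<kappa> = unit_ix j then 1 else 0)"
  defines "h \<equiv> \<lambda>z. \<chi> j. pseries (H j) z"
  shows "biholomorphic_germ_at_0 h" and "(h has_derivative (\<lambda>v. v)) (at 0)"
    and "\<forall>\<^sub>F z in nhds 0. (h has_derivative (\<lambda>v. \<chi> j. \<Sum>l\<in>UNIV. v $ l * pseries (pd l (H j)) z)) (at z)"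
proof -
  define D where "D z v = (\<chi> j. \<Sum>l\<in>UNIV. v $ l * pseries (pd l (H j)) z)" for z v :: "complex ^ 'n"
  have "\<forall>\<^sub>F z in nhds 0. \<forall>j. (pseries (H j) has_derivative (\<lambda>v. \<Sum>l\<in>UNIV. v $ l * pseries (pd l (H j)) z)) (at z)"
    by (intro eventually_all_finite pseries_has_derivative conv)
  moreover have "\<forall>\<^sub>F z in nhds 0. \<forall>j l. isCont (pseries (pd l (H j))) z"
  proof (intro eventually_all_finite)
    show "\<forall>\<^sub>F z in nhds 0. isCont (pseries (pd l (H j))) z" for j l
      using pseries_has_derivative[OF conv_series_pd[OF conv]]
      by (rule eventually_mono) (rule has_derivative_continuous)
  qed
  ultimately have "\<forall>\<^sub>F z in nhds 0. (\<forall>j. (pseries (H j) has_derivative (\<lambda>v. \<Sum>l\<in>UNIV. v $ l * pseries (pd l (H j)) z)) (at z))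
      \<and> (\<forall>j l. isCont (pseries (pd l (H j))) z)"
    by (rule eventually_conj)
  then obtain r where r: "r > 0" "\<And>z j. z \<in> polydisc r \<Longrightarrow>
      (pseries (H j) has_derivative (\<lambda>v. \<Sum>l\<in>UNIV. v $ l * pseries (pd l (H j)) z)) (at z)"
    "\<And>z j l. z \<in> polydisc r \<Longrightarrow> isCont (pseries (pd l (H j))) z"
    unfolding eventually_nhds_0_polydisc polydisc_def by blast
  let ?U = "polydisc r :: (complex ^ 'n) set"
  have zero: "0 \<in> ?U" using r(1) by (simp add: polydisc_def)
  have dh: "(h has_derivative D z) (at z)" if "z \<in> ?U" for z
    unfolding h_def D_def[abs_def] by (rule has_derivative_vec_lambda[OF r(2)[OF that]])
  show "\<forall>\<^sub>F z in nhds 0. (h has_derivative (\<lambda>v. \<chi> j. \<Sum>l\<in>UNIV. v $ l * pseries (pd l (H j)) z)) (at z)"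
    using eventually_nhds_in_open[OF open_polydisc zero]
    by (rule eventually_mono) (use dh in \<open>simp add: D_def[abs_def]\<close>)
  have D0: "D 0 = (\<lambda>v. v)"
  proof (rule ext)
    fix v :: "complex ^ 'n"
    have "pseries (pd l (H j)) 0 = (if l = j then 1 else 0)" for l j
      by (simp add: pseries_at_0 pd_at_0 low)
    then show "D 0 v = v"
      by (simp add: D_def Finite_Cartesian_Product.vec_eq_iff if_distrib[of "\<lambda>x. _ * x"] cong: if_cong)
  qed
  show "(h has_derivative (\<lambda>v. v)) (at 0)" using dh[OF zero] by (simp add: D0)
  have D_linear: "D z (c *s v) = c *s D z v" for z c v
    by (simp add: D_def Finite_Cartesian_Product.vec_eq_iff sum_distrib_left mult_ac)
  \<comment> \<open>Boundedness of \<open>D z\<close>, required to pass to bounded linear functions,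
    is read off from its being a derivative; hence the restriction to the polydisc.\<close>
  define f' where "f' z = Blinfun (D z)" for z
  have f': "blinfun_apply (f' z) = D z" if "z \<in> ?U" for z
    unfolding f'_def by (rule bounded_linear_Blinfun_apply[OF has_derivative_bounded_linear[OF dh[OF that]]])
  have der: "(h has_derivative blinfun_apply (f' z)) (at z)" if "z \<in> ?U" for z
    using dh[OF that] f'[OF that] by simp
  have cont: "continuous_on ?U f'"
  proof (rule continuous_on_blinfun_componentwise)
    fix i :: "complex ^ 'n"
    have "continuous_on ?U (\<lambda>z. D z i)"
      unfolding D_def using r(3)
      by (intro continuous_on_vec_lambda continuous_on_sum continuous_on_mult_left continuous_at_imp_continuous_on) auto
    then show "continuous_on ?U (\<lambda>z. blinfun_apply (f' z) i)"
      by (rule continuous_on_cong[THEN iffD1, rotated 2]) (auto simp: f')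
  qed
  have inv0: "id_blinfun o\<^sub>L f' 0 = id_blinfun"
    by (rule blinfun_eqI) (simp add: f'[OF zero] D0)
  obtain U' V g g' where ift: "open U'" "U' \<subseteq> ?U" "0 \<in> U'" "open V" "h 0 \<in> V" "homeomorphism U' V h g"
    "\<And>y. y \<in> V \<Longrightarrow> (g has_derivative (g' y)) (at y)"
    "\<And>y. y \<in> V \<Longrightarrow> g' y = inv_into UNIV (blinfun_apply (f' (g y)))"
    "\<And>y. y \<in> V \<Longrightarrow> bij (blinfun_apply (f' (g y)))"
    using inverse_function_theorem[OF open_polydisc der cont zero inv0] by metis
  have h0: "h 0 = 0"
    by (simp add: h_def Finite_Cartesian_Product.vec_eq_iff pseries_at_0 low unit_ix_neq_0[symmetric] del: unit_ix_neq_0)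
  have nth: "((\<lambda>z. F z $ k) has_derivative (\<lambda>v. F' v $ k)) (at z)"
    if "(F has_derivative F') (at z)" for F F' and z :: "complex ^ 'n" and k :: 'n
    by (rule bounded_linear.has_derivative[OF bounded_linear_vec_nth that])
  have "holomorphic_map_on h U'"
    unfolding holomorphic_map_on_def holomorphic_several_on_def
  proof (intro allI ballI)
    fix k z assume "z \<in> U'"
    then have "((\<lambda>z. h z $ k) has_derivative (\<lambda>v. D z v $ k)) (at z)"
      using ift(2) by (intro nth dh) auto
    then show "\<exists>D. ((\<lambda>z. h z $ k) has_derivative D) (at z) \<and> (\<forall>c v. D (c *s v) = c * D v)"
      by (intro exI[of _ "\<lambda>v. D z v $ k"]) (simp add: D_linear)
  qed
  moreover have "holomorphic_map_on g V"
    unfolding holomorphic_map_on_def holomorphic_several_on_def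
  proof (intro allI ballI)
    fix k y assume y: "y \<in> V"
    have gy: "g y \<in> ?U" using y ift(2,6) by (auto simp: homeomorphism_def)
    have "g' y (c *s v) = c *s g' y v" for c v
      using ift(8,9)[OF y] D_linear f'[OF gy] by (simp add: linear_inv_complex)
    then show "\<exists>D. ((\<lambda>z. g z $ k) has_derivative D) (at y) \<and> (\<forall>c v. D (c *s v) = c * D v)"
      using nth[OF ift(7)[OF y], of k] by (intro exI[of _ "\<lambda>v. g' y v $ k"]) simp
  qed
  ultimately show "biholomorphic_germ_at_0 h"
    unfolding biholomorphic_germ_at_0_def using h0 ift by blast
qed

context
  fixes lam :: "'n::finite \<Rightarrow> complex" and A :: "'n \<Rightarrow> ('n \<Rightarrow> nat) \<Rightarrow> complex"
    and X :: "complex ^ 'n \<Rightarrow> complex ^ 'n"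
  assumes nonres: "non_resonant lam" and low: "\<And>l \<beta>. mdeg \<beta> \<le> 1 \<Longrightarrow> A l \<beta> = 0"
    and conv: "\<And>l. conv_series (field_series lam A l)"
    and X: "\<forall>\<^sub>F z in nhds 0. \<forall>l. X z $ l = pseries (field_series lam A l) z"
begin

lemma linearizable_of_convergent:
  assumes H: "\<And>j. conv_series (formal_lin lam A j)"
  shows "linearizable_at_0 lam X"
proof -
  let ?H = "formal_lin lam A"
  define h where "h = (\<lambda>z. \<chi> j. pseries (?H j) z)"
  have bihol: "biholomorphic_germ_at_0 h" "(h has_derivative (\<lambda>v. v)) (at 0)"
    "\<forall>\<^sub>F z in nhds 0. (h has_derivative (\<lambda>v. \<chi> j. \<Sum>l\<in>UNIV. v $ l * pseries (pd l (?H j)) z)) (at z)"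
    unfolding h_def by (rule biholomorphic_germ_of_power_series[OF H]; simp add: formal_lin_low)+
  have eq: "\<forall>\<^sub>F z in nhds 0. \<forall>j. (\<Sum>l\<in>UNIV. pseries (field_series lam A l) z * pseries (pd l (?H j)) z) = lam j * pseries (?H j) z"
  proof (rule eventually_all_finite)
    fix j
    have formal: "(\<lambda>\<kappa>. \<Sum>l\<in>UNIV. cauchy_prod (pd l (?H j)) (field_series lam A l) \<kappa>) = (\<lambda>\<kappa>. lam j * ?H j \<kappa>)"
      using formal_lin_equation[OF nonres, of A, OF low] by (rule ext)
    show "\<forall>\<^sub>F z in nhds 0. (\<Sum>l\<in>UNIV. pseries (field_series lam A l) z * pseries (pd l (?H j)) z) = lam j * pseries (?H j) z"
      using linearization_operator_series(2)[where c = "?H j" and Y = "field_series lam A", OF H conv]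
      unfolding formal conv_series_cmult(2)[OF H] by (rule eventually_mono) (rule sym)
  qed
  from bihol(3) X eq have "\<forall>\<^sub>F z in nhds 0. frechet_derivative h (at z) (X z) = diagonal_field lam (h z)"
  proof eventually_elim
    case (elim z)
    have "frechet_derivative h (at z) = (\<lambda>v. \<chi> j. \<Sum>l\<in>UNIV. v $ l * pseries (pd l (?H j)) z)"
      by (rule frechet_derivative_at[OF elim(1), symmetric])
    then show ?case using elim(2,3) by (simp add: diagonal_field_def h_def)
  qed
  then show ?thesis unfolding linearizable_at_0_def using bihol(1,2) by blast
qed

text \<open>The Taylor series of any holomorphic linearization solves the formal equation with the
  same normalization, so by uniqueness it is \<open>formal_lin\<close>, which therefore
  converges.\<close>

lemma convergent_of_linearizable:
  assumes "linearizable_at_0 lam X"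
  shows "conv_series (formal_lin lam A j)"
proof -
  obtain h where h: "biholomorphic_germ_at_0 h" "(h has_derivative (\<lambda>v. v)) (at 0)"
    "\<forall>\<^sub>F z in nhds 0. frechet_derivative h (at z) (X z) = diagonal_field lam (h z)"
    using assms unfolding linearizable_at_0_def by blast
  have h0: "h 0 = 0" using h(1) by (simp add: biholomorphic_germ_at_0_def)
  have "holomorphic_germ_at_0 (\<lambda>z. h z $ j)" for j
    using h(1) unfolding biholomorphic_germ_at_0_def holomorphic_map_on_def holomorphic_germ_at_0_def by blast
  then have "\<exists>c. conv_series c \<and> (\<forall>\<^sub>F z in nhds 0. h z $ j = pseries c z)" for j
    by (rule holomorphic_germ_power_series)
  then obtain c where c: "\<And>j. conv_series (c j)" "\<And>j. \<forall>\<^sub>F z in nhds 0. h z $ j = pseries (c j) z"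
    by metis
  have c_low: "c j \<kappa> = (if \<kappa> = unit_ix j then 1 else 0)" if "mdeg \<kappa> \<le> 1" for j \<kappa>
    using that
  proof (cases rule: mdeg_le_1_cases)
    case 1
    then show ?thesis using series_first_order(1)[OF c(1,2), of j] h0
      by (simp add: unit_ix_neq_0[symmetric] del: unit_ix_neq_0)
  next
    case (2 l)
    have "((\<lambda>z. h z $ j) has_derivative (\<lambda>v. v $ j)) (at 0)"
      by (rule bounded_linear.has_derivative[OF bounded_linear_vec_nth h(2)])
    from series_first_order(2)[OF c(1,2) this, of l] show ?thesis
      using 2 by (auto simp: axis_def)
  qed
  have ev: "\<forall>\<^sub>F z in nhds 0. \<forall>j. h z $ j = pseries (c j) z"
    by (intro eventually_all_finite c(2))
  \<comment> \<open>Derivatives of \<open>h\<close> and of its series can be compared at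
    \<open>z\<close> only if both agree on a neighbourhood of \<open>z\<close>.\<close>
  then have nested: "\<forall>\<^sub>F z in nhds 0. \<forall>\<^sub>F w in nhds z. \<forall>j. h w $ j = pseries (c j) w"
    unfolding eventually_eventually .
  have "\<forall>\<^sub>F z in nhds 0. \<forall>j. (pseries (c j) has_derivative (\<lambda>v. \<Sum>l\<in>UNIV. v $ l * pseries (pd l (c j)) z)) (at z)"
    by (intro eventually_all_finite pseries_has_derivative c(1))
  with nested X h(3) ev
  have eq: "\<forall>\<^sub>F z in nhds 0. \<forall>j. (\<Sum>l\<in>UNIV. pseries (field_series lam A l) z * pseries (pd l (c j)) z) = lam j * pseries (c j) z"
  proof eventually_elim
    case (elim z)
    have "((\<lambda>w. h w $ j) has_derivative (\<lambda>v. \<Sum>l\<in>UNIV. v $ l * pseries (pd l (c j)) z)) (at z)" for j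
      using elim(5)[rule_format, of j]
    proof (rule has_derivative_transform_eventually)
      show "\<forall>\<^sub>F w in at z. pseries (c j) w = h w $ j"
        unfolding eventually_at_filter using elim(1) by (rule eventually_mono) simp
    qed (use elim(4) in auto)
    then have "((\<lambda>w. \<chi> j. h w $ j) has_derivative (\<lambda>v. \<chi> j. \<Sum>l\<in>UNIV. v $ l * pseries (pd l (c j)) z)) (at z)"
      by (rule has_derivative_vec_lambda)
    then have "frechet_derivative h (at z) = (\<lambda>v. \<chi> j. \<Sum>l\<in>UNIV. v $ l * pseries (pd l (c j)) z)"
      by (intro frechet_derivative_at[symmetric]) simp
    with elim(2,3,4) show ?case by (simp add: diagonal_field_def Finite_Cartesian_Product.vec_eq_iff)
  qed
  have "(\<lambda>\<kappa>. \<Sum>l\<in>UNIV. cauchy_prod (pd l (c j)) (field_series lam A l) \<kappa>) = (\<lambda>\<kappa>. lam j * c j \<kappa>)" for j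
  proof (rule pseries_unique)
    show "conv_series (\<lambda>\<kappa>. \<Sum>l\<in>UNIV. cauchy_prod (pd l (c j)) (field_series lam A l) \<kappa>)"
      by (rule linearization_operator_series(1)[OF c(1) conv])
    show "conv_series (\<lambda>\<kappa>. lam j * c j \<kappa>)" by (rule conv_series_cmult(1)[OF c(1)])
    show "\<forall>\<^sub>F z in nhds 0. pseries (\<lambda>\<kappa>. \<Sum>l\<in>UNIV. cauchy_prod (pd l (c j)) (field_series lam A l) \<kappa>) z =
        pseries (\<lambda>\<kappa>. lam j * c j \<kappa>) z"
      using linearization_operator_series(2)[where c = "c j" and Y = "field_series lam A", OF c(1) conv] eq
      by eventually_elim (simp add: conv_series_cmult(2)[OF c(1)])
  qed
  from formal_lin_unique[OF nonres, of A, OF low c_low fun_cong[OF this]]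
  have "c j = formal_lin lam A j" by (intro ext) blast
  then show ?thesis using c(1)[of j] by simp
qed

end

text \<open>Gives the simultaneous convergence of the component series the shape of
  \<open>geometric_set\<close>, indexed by pairs. As all rates are at least 1 and finite in number,
  their sum is a common rate.\<close>

lemma conv_series_all_iff:
  "(\<forall>j::'n::finite. conv_series (H j)) \<longleftrightarrow> (\<exists>L. \<forall>p. cmod (H (fst p) (snd p)) \<le> L ^ Suc (mdeg (snd p)))"
proof
  assume "\<forall>j. conv_series (H j)"
  then have "\<exists>L\<ge>1. \<forall>\<kappa>. cmod (H j \<kappa>) \<le> L * L ^ mdeg \<kappa>" for j by (metis conv_seriesE)
  then obtain L where L: "\<And>j. L j \<ge> (1 :: real)" "\<And>j \<kappa>. cmod (H j \<kappa>) \<le> L j * L j ^ mdeg \<kappa>"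
    by metis
  have "cmod (H j \<kappa>) \<le> (\<Sum>j\<in>UNIV. L j) ^ Suc (mdeg \<kappa>)" for j \<kappa>
  proof -
    have "L j \<le> (\<Sum>j\<in>UNIV. L j)" using L(1) by (intro member_le_sum) (auto intro: order_trans[OF zero_le_one])
    then have "L j ^ Suc (mdeg \<kappa>) \<le> (\<Sum>j\<in>UNIV. L j) ^ Suc (mdeg \<kappa>)"
      using L(1)[of j] by (intro power_mono) auto
    then show ?thesis using L(2)[of j \<kappa>] by simp
  qed
  then show "\<exists>L. \<forall>p. cmod (H (fst p) (snd p)) \<le> L ^ Suc (mdeg (snd p))" by blast
qed (auto simp: conv_series_def)

theorem theorem5:
  fixes m d :: nat
    and lam :: "'n::finite \<Rightarrow> complex"
    and f :: "'n \<Rightarrow> nat Matrix.vec \<Rightarrow> complex ^ 'n \<Rightarrow> complex"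
  assumes "m \<ge> 1" and "d \<ge> 1"
    and "\<And>j i. i \<in> multi_indices m d \<Longrightarrow> holomorphic_germ_at_0 (f j i)"
    and "\<And>j i. i \<in> multi_indices m d \<Longrightarrow> vanishes_to_order_2_at_0 (f j i)"
    and "non_resonant lam"
  shows "(\<forall>t \<in> carrier_vec m. linearizable_at_0 lam (polynomial_family m d lam f t)) \<or>
         (\<exists>E \<subseteq> carrier_vec m. Gamma_capacity m E = 0 \<and>
            (\<forall>t \<in> carrier_vec m - E. \<not> linearizable_at_0 lam (polynomial_family m d lam f t)))"
proof -
  let ?M = "multi_indices m d"
  \<comment> \<open>The series of the \<open>f l i\<close> are chosen before the parameter, so that
    \<open>A t\<close> below is polynomial in \<open>t\<close> with fixed coefficients.\<close>
  define C where "C l i = (SOME c. conv_series c \<and> (\<forall>\<^sub>F z in nhds 0. f l i z = pseries c z))" for l i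
  have C: "conv_series (C l i)" "\<forall>\<^sub>F z in nhds 0. f l i z = pseries (C l i) z" if "i \<in> ?M" for l i
    using someI_ex[OF holomorphic_germ_power_series[OF assms(3)[OF that]], of l] unfolding C_def by blast+
  have C_low: "C l i \<kappa> = 0" if i: "i \<in> ?M" and "mdeg \<kappa> \<le> 1" for l i \<kappa>
    using that(2)
  proof (cases rule: mdeg_le_1_cases)
    case 1
    then show ?thesis using series_first_order(1)[OF C[OF i]] assms(4)[OF i]
      by (simp add: vanishes_to_order_2_at_0_def)
  next
    case (2 k)
    then show ?thesis using series_first_order(2)[OF C[OF i]] assms(4)[OF i]
      by (auto simp: vanishes_to_order_2_at_0_def)
  qed
  define A where "A t l \<kappa> = (\<Sum>i\<in>?M. monomial_vec m t i * C l i \<kappa>)" for t l \<kappa>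
  have A_low: "A t l \<kappa> = 0" if "mdeg \<kappa> \<le> 1" for t l \<kappa>
    using C_low[OF _ that] by (simp add: A_def)
  have A_series: "conv_series (A t l) \<and>
      (\<forall>\<^sub>F z in nhds 0. pseries (A t l) z = (\<Sum>i\<in>?M. monomial_vec m t i * pseries (C l i) z))" for t l
    using conv_series_sum[OF finite_multi_indices conv_series_cmult(1)[OF C(1)], of m d "\<lambda>i. i" "\<lambda>i. monomial_vec m t i" "\<lambda>_. l"]
      conv_series_cmult(2)[OF C(1)] by (simp add: A_def[abs_def])
  have field_conv: "conv_series (field_series lam (A t) l)" for t l
    unfolding field_series_def[abs_def]
    by (rule conv_series_add(1)[OF conv_series_unit]) (use A_series in blast)
  have field: "\<forall>\<^sub>F z in nhds 0. \<forall>l. polynomial_family m d lam f t z $ l = pseries (field_series lam (A t) l) z" for t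
  proof (rule eventually_all_finite)
    fix l
    have "\<forall>\<^sub>F z in nhds 0. \<forall>i\<in>?M. f l i z = pseries (C l i) z"
      by (intro eventually_ball_finite finite_multi_indices ballI C(2))
    moreover have "\<forall>\<^sub>F z in nhds 0. pseries (field_series lam (A t) l) z = lam l * z $ l + pseries (A t l) z"
      using conv_series_add(2)[OF conv_series_unit, of "A t l" l "lam l"] A_series
      unfolding field_series_def[abs_def] pseries_unit by blast
    moreover have "\<forall>\<^sub>F z in nhds 0. pseries (A t l) z = (\<Sum>i\<in>?M. monomial_vec m t i * pseries (C l i) z)"
      using A_series by blast
    ultimately show "\<forall>\<^sub>F z in nhds 0. polynomial_family m d lam f t z $ l = pseries (field_series lam (A t) l) z"
      by eventually_elim (simp add: polynomial_family_def)
  qed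
  \<comment> \<open>The exponent in \<open>conv_series\<close>. It exceeds \<open>mdeg\<close>, so
    the degree bound \<open>d * mdeg \<kappa>\<close> of the coefficients gives the one required by
    the dichotomy.\<close>
  let ?wt = "\<lambda>p :: 'n \<times> ('n \<Rightarrow> nat). Suc (mdeg (snd p))"
  let ?P = "\<lambda>p t. formal_lin lam (A t) (fst p) (snd p)"
  let ?E = "geometric_set m ?wt ?P"
  have lin_iff: "linearizable_at_0 lam (polynomial_family m d lam f t) \<longleftrightarrow> t \<in> ?E" if "t \<in> carrier_vec m" for t
  proof -
    have "linearizable_at_0 lam (polynomial_family m d lam f t) \<longleftrightarrow> (\<forall>j. conv_series (formal_lin lam (A t) j))"
      using linearizable_of_convergent[OF assms(5) A_low field_conv field]
        convergent_of_linearizable[OF assms(5) A_low field_conv field] by blast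
    then show ?thesis using that by (simp add: conv_series_all_iff geometric_set_def)
  qed
  have A_poly: "line_poly m d (\<lambda>t. A t l \<kappa>)" for l \<kappa>
    unfolding A_def using line_poly_mult[OF line_poly_monomial_vec line_poly_const[of m 0]]
    by (intro line_poly_sum) simp
  have "line_poly m (d * ?wt p) (?P p)" for p
    by (rule line_poly_mono[OF line_poly_formal_lin[where A = A, OF A_poly]]) simp
  from geometric_set_dichotomy[where P = ?P and wt = ?wt, OF assms(1) this]
  consider "?E = carrier_vec m" | "Gamma_capacity m ?E = 0" by blast
  then show ?thesis
  proof cases
    case 1
    then show ?thesis using lin_iff by blast
  next
    case 2
    then show ?thesis using lin_iff by (intro disjI2 exI[of _ ?E]) (auto simp: geometric_set_def)
  qed
qed

end
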